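(* Consider two systems described by the sets of matrices $\mathcal{D}=\{S,A,\bar A,B,\bar B\}$ and $\hat{\mathcal{D}}=\{\hat S,\hat A,\hat{\bar A},\hat B,\hat{\bar B}\}$. Let these systems be controlled by a graph neural network (GNN) with filter taps $\mathcal{H}$, consisting of $L$ layers of graph filters $\mathsf{H}_\ell(\cdot;\cdot,\mathcal{H}_\ell)$ with $F_\ell$ features and $K_\ell$ filter taps each. Let the nonlinearity $\sigma:\mathbb{R}\to\mathbb{R}$ be such that $|\sigma(a)-\sigma(b)|\le|a-b|$ and $\sigma(0)=0$. Let $\{X(t)\}$ and $\{\hat X(t)\}$ be the respective closed-loop trajectories, started from the same initial state $\hat X(0)=X(0)$. Then $$\|X(t)-\hat X(t)\|\le\hat C_\Phi\,\hat C_t\,\|X(0)\|\,d(\mathcal{D},\hat{\mathcal{D}}),$$ with $$\hat C_\Phi=\hat C_\xi+C_\Phi\,\Gamma_\Phi\,\|\hat B\|_2\,\|\hat{\bar B}\|_\infty\,(1+8\sqrt N),\qquad \hat C_\xi=\|A\|_2+\|\hat{\bar A}\|_\infty+C_\Phi\big(\|B\|_2+\|\hat{\bar B}\|_\infty\big),$$ $$C_\Phi=\prod_{\ell=1}^LC_{\mathsf{H}_\ell},\qquad \Gamma_\Phi=\sum_{\ell=1}^L\frac{\Gamma_{\mathsf{H}_\ell}}{C_{\mathsf{H}_\ell}},$$ where $C_{\mathsf{H}_\ell}$ and $\Gamma_{\mathsf{H}_\ell}$ are the size and the Lipschitz constant of the $\ell$-th filter, and with $\hat C_t$ such that $\hat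 C_0=0$ and $$\hat C_t=t\,\max\{\xi,\hat\xi\}^{t-1}\quad\text{for } t\ge1,$$ where $\xi=\|A\|_2\|\bar A\|_\infty+C_\Phi\|B\|_2\|\bar B\|_\infty$ and $\hat\xi=\|\hat A\|_2\|\hat{\bar A}\|_\infty+C_\Phi\|\hat B\|_2\|\hat{\bar B}\|_\infty$ are the stability constants of $\mathcal{D}$ and $\hat{\mathcal{D}}$.
   Context: Norms. For $X\in\mathbb{R}^{N\times F}$ with columns $x^1,\dots,x^F$, $\|X\|=\sum_{f=1}^F\|x^f\|_2$. For matrices, $\|\cdot\|_2$ is the spectral norm and $\|\cdot\|_\infty$ is the maximum absolute row sum. Systems. $S,\hat S,A,\hat A,B,\hat B\in\mathbb{R}^{N\times N}$, $\bar A,\hat{\bar A}\in\mathbb{R}^{F\times F}$, $\bar B,\hat{\bar B}\in\mathbb{R}^{G\times F}$. $S$ is a support matrix of a graph with nodes $v_1,\dots,v_N$ and edge set $\mathcal{E}\subseteq\mathcal{V}\times\mathcal{V}$, where $\mathcal{V}=\{v_1,\dots,v_N\}$: any matrix such that $[S]_{ij}$ can be nonzero only if $i=j$ or $(v_j,v_i)\in\mathcal{E}$. $\hat S$ is an estimate of the support matrix (the exact graph support being unknown), and the other hatted matrices are estimates of their counterparts. The closed-loop dynamics are $X(t+1)=A\,X(t)\,\bar A+B\,U(t)\,\bar B$ with $U(t)=\Phi(X(t);S,\mathcal{H})$ for $\mathcal{D}$, and $\hat X(t+1)=\hat A\,\hat X(t)\,\hat{\bar A}+\hat B\,\hat U(t)\,\hat{\bar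 B}$ with $\hat U(t)=\Phi(\hat X(t);\hat S,\mathcal{H})$ for $\hat{\mathcal{D}}$, $t=0,1,2,\dots$, with states in $\mathbb{R}^{N\times F}$ and controls in $\mathbb{R}^{N\times G}$. Distance. $d(\mathcal{D},\hat{\mathcal{D}})=\varepsilon$, where $\varepsilon>0$ is the smallest number such that $\|S-\hat S\|_2\le\varepsilon$, $\|A-\hat A\|_2\le\varepsilon$, $\|\bar A-\hat{\bar A}\|_\infty\le\varepsilon$, $\|B-\hat B\|_2\le\varepsilon$, $\|\bar B-\hat{\bar B}\|_\infty\le\varepsilon$. Graph filter. For taps $\mathcal{H}=\{H_k\in\mathbb{R}^{F\times G}\}_{k=0}^K$, $\mathsf{H}(X;S,\mathcal{H})=\sum_{k=0}^KS^kXH_k$. Its frequency response is the collection of polynomials $h_{fg}(\lambda)=\sum_{k=0}^K[H_k]_{fg}\lambda^k$, $\lambda\in[\lambda_l,\lambda_h]$, where $\lambda_l,\lambda_h$ are determined by the problem under study; they are typically the minimum and maximum eigenvalues of the given support matrix, and when the filters act on more than one graph it may be convenient to select the interval so that it contains all the eigenvalues of all the support matrices under consideration. The size of the filter is $C_{\mathsf{H}}=\|C\|_\infty$, where $[C]_{fg}=\max_{\lambda\in[\lambda_l,\lambda_h]}|h_{fg}(\lambda)|$. The filters are Lipschitz: $|h_{fg}(\lambda_1)-h_{fg}(\lambda_2)|\le\gamma_{fg}|\lambda_1-\lambda_2|$ for all $\lambda_1,\lambda_2\in[\lambda_l,\lambda_h]$, for some constants $\gamma_{fg}>0$; the Lipschitz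 constant of the filter is $\Gamma_{\mathsf{H}}=\|\Gamma\|_\infty$, where $[\Gamma]_{fg}=\gamma_{fg}$. GNN. $X_0=X$, $X_\ell=\sigma(\mathsf{H}_\ell(X_{\ell-1};S,\mathcal{H}_\ell))$ for $\ell=1,\dots,L$, $\Phi(X;S,\mathcal{H})=X_L$, with $\sigma$ applied entrywise, $\mathcal{H}_\ell=\{H_{\ell k}\in\mathbb{R}^{F_{\ell-1}\times F_\ell}\}_{k=0}^{K_\ell}$, $\mathcal{H}=\bigcup_{\ell=1}^L\mathcal{H}_\ell$, $F_0=F$, $F_L=G$.
   Formalization: The support matrices S and Ŝ are additionally assumed symmetric, and the interval [λ_l, λ_h] is assumed to contain all eigenvalues of both; without these the stated bound fails. *)

theory Defs
  imports "Jordan_Normal_Form.Char_Poly" "HOL-Analysis.L2_Norm"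
begin

section \<open>Norms\<close>

definition vec_l2 :: "real vec \<Rightarrow> real" where
  "vec_l2 v = L2_set (\<lambda>i. v $ i) {..<dim_vec v}"

definition signal_norm :: "real mat \<Rightarrow> real" where
  "signal_norm X = (\<Sum>f<dim_col X. vec_l2 (col X f))"

definition spectral_norm :: "real mat \<Rightarrow> real" where
  "spectral_norm A = (SUP x \<in> {x \<in> carrier_vec (dim_col A). vec_l2 x \<le> 1}. vec_l2 (A *\<^sub>v x))"

text \<open>The maximum absolute row sum; it is only meaningful for matrices with at least one row.\<close>

definition row_sum_norm :: "real mat \<Rightarrow> real" where
  "row_sum_norm A = Max ((\<lambda>i. \<Sum>j<dim_col A. \<bar>A $$ (i, j)\<bar>) ` {..<dim_row A})"


section \<open>Graphs and their support matrices\<close>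

text \<open>Nodes are numbered from 0; a pair (j, i) is an edge from node j to node i.\<close>

definition support_matrix :: "nat \<Rightarrow> (nat \<times> nat) set \<Rightarrow> real mat \<Rightarrow> bool" where
  "support_matrix N E S \<longleftrightarrow> S \<in> carrier_mat N N \<and>
     (\<forall>i<N. \<forall>j<N. S $$ (i, j) \<noteq> 0 \<longrightarrow> i = j \<or> (j, i) \<in> E)"

definition spectrum_in :: "real mat \<Rightarrow> real \<Rightarrow> real \<Rightarrow> bool" where
  "spectrum_in S lo hi \<longleftrightarrow> (\<forall>\<mu>. eigenvalue S \<mu> \<longrightarrow> \<mu> \<in> {lo..hi})"

text \<open>For a symmetric S every complex eigenvalue is real, so this is the whole spectrum, and the
  frequency responses on the interval determine the action of a filter. For non-symmetric S
  they do not: S = (0 1; 0 0) has the single eigenvalue 0.\<close>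


section \<open>Graph filters\<close>

text \<open>Taps are given as \<open>H k\<close> for \<open>k \<le> K\<close>.\<close>

definition graph_filter :: "nat \<Rightarrow> (nat \<Rightarrow> real mat) \<Rightarrow> real mat \<Rightarrow> real mat \<Rightarrow> real mat" where
  "graph_filter K H S X =
     mat (dim_row X) (dim_col (H 0)) (\<lambda>ij. \<Sum>k\<le>K. (S ^\<^sub>m k * X * H k) $$ ij)"

definition freq_response :: "nat \<Rightarrow> (nat \<Rightarrow> real mat) \<Rightarrow> nat \<Rightarrow> nat \<Rightarrow> real \<Rightarrow> real" where
  "freq_response K H f g x = (\<Sum>k\<le>K. H k $$ (f, g) * x ^ k)"

text \<open>The supremum below is a maximum, as a polynomial is maximised over a compact interval.\<close>

definition filter_size :: "real \<Rightarrow> real \<Rightarrow> nat \<Rightarrow> (nat \<Rightarrow> real mat) \<Rightarrow> real" where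
  "filter_size lo hi K H = row_sum_norm
     (mat (dim_row (H 0)) (dim_col (H 0))
       (\<lambda>(f, g). SUP x \<in> {lo..hi}. \<bar>freq_response K H f g x\<bar>))"

text \<open>The entries of \<open>\<gamma>\<close> are Lipschitz constants of the frequency responses; the Lipschitz constant
  of the filter is then \<open>row_sum_norm \<gamma>\<close>.\<close>

definition filter_lipschitz ::
  "real \<Rightarrow> real \<Rightarrow> nat \<Rightarrow> (nat \<Rightarrow> real mat) \<Rightarrow> real mat \<Rightarrow> bool" where
  "filter_lipschitz lo hi K H \<gamma> \<longleftrightarrow> \<gamma> \<in> carrier_mat (dim_row (H 0)) (dim_col (H 0)) \<and>
     (\<forall>f<dim_row (H 0). \<forall>g<dim_col (H 0). \<gamma> $$ (f, g) > 0 \<and>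
       (\<forall>x\<in>{lo..hi}. \<forall>y\<in>{lo..hi}.
          \<bar>freq_response K H f g x - freq_response K H f g y\<bar> \<le> \<gamma> $$ (f, g) * \<bar>x - y\<bar>))"


section \<open>Graph neural networks\<close>

text \<open>Layers are numbered from 1: \<open>H l k\<close> for \<open>k \<le> K l\<close> are the taps of layer l, which has
  \<open>Ft l\<close> output features, and \<open>Ft 0\<close> is the number of features of the input.\<close>

definition gnn_taps :: "nat \<Rightarrow> (nat \<Rightarrow> nat) \<Rightarrow> (nat \<Rightarrow> nat) \<Rightarrow> (nat \<Rightarrow> nat \<Rightarrow> real mat) \<Rightarrow> bool" where
  "gnn_taps L Ft K H \<longleftrightarrow>
     (\<forall>l\<in>{1..L}. \<forall>k\<le>K l. H l k \<in> carrier_mat (Ft (l - 1)) (Ft l))"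

primrec gnn :: "(real \<Rightarrow> real) \<Rightarrow> (nat \<Rightarrow> nat) \<Rightarrow> (nat \<Rightarrow> nat \<Rightarrow> real mat) \<Rightarrow>
    nat \<Rightarrow> real mat \<Rightarrow> real mat \<Rightarrow> real mat" where
  "gnn \<sigma> K H 0 X S = X"
| "gnn \<sigma> K H (Suc l) X S = map_mat \<sigma> (graph_filter (K (Suc l)) (H (Suc l)) S (gnn \<sigma> K H l X S))"

definition gnn_size :: "real \<Rightarrow> real \<Rightarrow> (nat \<Rightarrow> nat) \<Rightarrow> (nat \<Rightarrow> nat \<Rightarrow> real mat) \<Rightarrow> nat \<Rightarrow> real" where
  "gnn_size lo hi K H L = (\<Prod>l=1..L. filter_size lo hi (K l) (H l))"

text \<open>If some layer has size 0, then \<open>gnn_size\<close> vanishes, and so does its product with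
  \<open>gnn_lip\<close>, whatever value the quotient for that layer is given.\<close>

definition gnn_lip :: "real \<Rightarrow> real \<Rightarrow> (nat \<Rightarrow> nat) \<Rightarrow> (nat \<Rightarrow> nat \<Rightarrow> real mat) \<Rightarrow>
    (nat \<Rightarrow> real mat) \<Rightarrow> nat \<Rightarrow> real" where
  "gnn_lip lo hi K H \<gamma> L = (\<Sum>l=1..L. row_sum_norm (\<gamma> l) / filter_size lo hi (K l) (H l))"


section \<open>Closed-loop systems\<close>

text \<open>A system is a tuple (S, A, Ab, B, Bb), where Ab and Bb multiply the state and the control
  from the right.\<close>

type_synonym system = "real mat \<times> real mat \<times> real mat \<times> real mat \<times> real mat"

fun system_dims :: "nat \<Rightarrow> nat \<Rightarrow> nat \<Rightarrow> system \<Rightarrow> bool" where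
  "system_dims N F G (S, A, Ab, B, Bb) \<longleftrightarrow>
     S \<in> carrier_mat N N \<and> A \<in> carrier_mat N N \<and> Ab \<in> carrier_mat F F \<and>
     B \<in> carrier_mat N N \<and> Bb \<in> carrier_mat G F"

fun closed_loop :: "(real mat \<Rightarrow> real mat \<Rightarrow> real mat) \<Rightarrow> system \<Rightarrow> (nat \<Rightarrow> real mat) \<Rightarrow> bool" where
  "closed_loop \<Phi> (S, A, Ab, B, Bb) X \<longleftrightarrow>
     (\<forall>t. X (Suc t) = A * X t * Ab + B * \<Phi> (X t) S * Bb)"

text \<open>The infimum equals the least admissible number whenever that exists, that is, for distinct
  systems. For equal systems there is no least positive number, and the infimum is 0.\<close>

fun system_dist :: "system \<Rightarrow> system \<Rightarrow> real" where
  "system_dist (S, A, Ab, B, Bb) (S', A', Ab', B', Bb') =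
     Inf {\<epsilon>. \<epsilon> > 0 \<and> spectral_norm (S - S') \<le> \<epsilon> \<and>
       spectral_norm (A - A') \<le> \<epsilon> \<and> row_sum_norm (Ab - Ab') \<le> \<epsilon> \<and>
       spectral_norm (B - B') \<le> \<epsilon> \<and> row_sum_norm (Bb - Bb') \<le> \<epsilon>}"

text \<open>In the following the first argument is the size of the GNN.\<close>

fun stability_const :: "real \<Rightarrow> system \<Rightarrow> real" where
  "stability_const C (S, A, Ab, B, Bb) =
     spectral_norm A * row_sum_norm Ab + C * spectral_norm B * row_sum_norm Bb"

fun C_xi_hat :: "real \<Rightarrow> system \<Rightarrow> system \<Rightarrow> real" where
  "C_xi_hat C (S, A, Ab, B, Bb) (S', A', Ab', B', Bb') =
     spectral_norm A + row_sum_norm Ab' + C * (spectral_norm B + row_sum_norm Bb')"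

text \<open>The arguments \<open>C\<close> and \<open>\<Gamma>\<close> are the size and the Lipschitz constant of the GNN.\<close>

fun C_Phi_hat :: "real \<Rightarrow> real \<Rightarrow> nat \<Rightarrow> system \<Rightarrow> system \<Rightarrow> real" where
  "C_Phi_hat C \<Gamma> N D (S', A', Ab', B', Bb') =
     C_xi_hat C D (S', A', Ab', B', Bb') +
     C * \<Gamma> * spectral_norm B' * row_sum_norm Bb' * (1 + 8 * sqrt (real N))"

definition C_t_hat :: "real \<Rightarrow> system \<Rightarrow> system \<Rightarrow> nat \<Rightarrow> real" where
  "C_t_hat C D D' t =
     (if t = 0 then 0
      else real t * max (stability_const C D) (stability_const C D') ^ (t - 1))"

end

theory Submission
  imports Defs "Jordan_Normal_Form.Schur_Decomposition"
begin

text \<open>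
  The only spectral input is a perturbation bound for a symmetric support matrix: writing
  \<open>S = U D U\<^sup>T\<close> and \<open>T = V E V\<^sup>T\<close> with orthogonal \<open>U\<close>, \<open>V\<close>, the entries of
  \<open>U\<^sup>T (p(S) - p(T)) V\<close> are \<open>(p(d\<^sub>i) - p(e\<^sub>j)) (U\<^sup>T V)\<^sub>i\<^sub>j\<close>, hence bounded by the Lipschitz
  constant of \<open>p\<close> times the entries of \<open>U\<^sup>T (S - T) V\<close>. Passing through the Frobenius norm gives
  \<open>\<parallel>p(S) - p(T)\<parallel> \<le> \<gamma> \<surd>N \<parallel>S - T\<parallel>\<close>, which is already sharper than the factor \<open>1 + 8\<surd>N\<close>.
  Telescoping over the layers and over the two products in the dynamics turns this into the linear
  recursion \<open>e (t+1) \<le> \<xi>' e t + c \<parallel>X t\<parallel>\<close> for the trajectory error, where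
  \<open>\<parallel>X t\<parallel> \<le> \<xi>\<^sup>t \<parallel>X 0\<parallel>\<close>.
\<close>

section \<open>Diagonalization of real symmetric matrices\<close>

text \<open>Over the complex numbers the characteristic polynomial splits, so an eigenvector
  \<open>v\<close> with eigenvalue \<open>a\<close> exists. Moving the real symmetric matrix across
  the form \<open>v \<bullet>c v\<close> yields both \<open>a\<close> and \<open>cnj a\<close> times
  the same nonzero number; hence \<open>a\<close> is real and a root of the real characteristic
  polynomial.\<close>

lemma symmetric_mat_has_eigenvalue:
  fixes S :: "real mat"
  assumes S: "S \<in> carrier_mat n n" and sym: "transpose_mat S = S" and n: "n > 0"
  shows "\<exists>e. eigenvalue S e"
proof -
  let ?C = "map_mat complex_of_real S"
  have C: "?C \<in> carrier_mat n n" using S by simp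
  obtain as where as: "char_poly ?C = (\<Prod>a\<leftarrow>as. [:- a, 1:])" "length as = n"
    using char_poly_factorized[OF C] by blast
  then obtain a where "a \<in> set as" using n by (cases as) auto
  then have root: "poly (char_poly ?C) a = 0"
    unfolding as(1) by (auto simp: poly_prod_list)
  then obtain v where v: "v \<in> carrier_vec n" "v \<noteq> 0\<^sub>v n" "?C *\<^sub>v v = a \<cdot>\<^sub>v v"
    using eigenvalue_root_char_poly[OF C] S unfolding eigenvalue_def eigenvector_def by auto
  have tr: "transpose_mat ?C = ?C"
    using sym by (metis map_mat_transpose)
  \<comment> \<open>The entries of \<open>?C\<close> are real, so conjugation acts on the vector
    only.\<close>
  have cc: "conjugate (?C *\<^sub>v v) = ?C *\<^sub>v conjugate v"
    using S v(1) by (intro eq_vecI) (auto simp: scalar_prod_def sum_conjugate conjugate_dist_mul)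
  have "a * (v \<bullet>c v) = (?C *\<^sub>v v) \<bullet>c v"
    using v by simp
  also have "\<dots> = v \<bullet> (?C *\<^sub>v conjugate v)"
    using transpose_vec_mult_scalar[of ?C n n "conjugate v" v] C v(1) tr by auto
  also have "\<dots> = v \<bullet>c (?C *\<^sub>v v)"
    by (simp add: cc)
  also have "\<dots> = cnj a * (v \<bullet>c v)"
    using v by (simp add: conjugate_smult_vec)
  finally have "a = cnj a"
    using v conjugate_square_eq_0_vec[OF v(1)] by simp
  then obtain r where r: "a = of_real r"
    by (metis Reals_cnj_iff Reals_cases)
  have "poly (char_poly S) r = 0"
    using root unfolding r of_real_hom.char_poly_hom[OF S] by simp
  then show ?thesis
    using eigenvalue_root_char_poly[OF S] by blast
qed

text \<open>Extend \<open>v\<close> to a basis, apply Gram-Schmidt, which keeps the first vector,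
  and divide each column by its length. The factor \<open>c\<close> is the reciprocal of the length
  of \<open>v\<close>.\<close>

lemma orthogonal_mat_with_first_col:
  fixes v :: "real vec"
  assumes v: "v \<in> carrier_vec n" and v0: "v \<noteq> 0\<^sub>v n"
  obtains W c where "W \<in> carrier_mat n n" "transpose_mat W * W = 1\<^sub>m n" "col W 0 = c \<cdot>\<^sub>v v"
proof -
  interpret cof_vec_space n "TYPE(real)" .
  have n: "n > 0"
    using v v0 by (cases n) auto
  define b where "b = basis_completion v"
  note b = basis_completion[OF v v0, folded b_def]
  define ws where "ws = gram_schmidt n b"
  note ws = gram_schmidt_result[OF b(2,4,5) ws_def]
  obtain vs where "b = v # vs" using b(6,7) n by (cases b) auto
  then have ws0: "ws ! 0 = v"
    using gram_schmidt_hd[OF v, of vs] ws(4) b(6) n hd_conv_nth[of ws]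
    by (metis length_greater_0_conv ws_def)
  have wsc: "ws ! i \<in> carrier_vec n" if "i < n" for i
    using ws(3,4) b(6) that by auto
  have orth: "ws ! i \<bullet> ws ! j = 0 \<longleftrightarrow> i \<noteq> j" if "i < n" "j < n" for i j
    using corthogonalD[OF ws(2), of i j] ws(4) b(6) that
    by (simp add: conjugate_vec_def vec_eq_iff)
  define l where "l j = sqrt (ws ! j \<bullet> ws ! j)" for j
  define W where "W = mat n n (\<lambda>(i, j). ws ! j $ i / l j)"
  have W: "W \<in> carrier_mat n n" by (simp add: W_def)
  have colW: "col W j = (1 / l j) \<cdot>\<^sub>v ws ! j" if "j < n" for j
    using wsc[OF that] that by (intro eq_vecI) (auto simp: W_def)
  \<comment> \<open>The diagonal case of \<open>orth\<close> says that no Gram-Schmidt vector is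
    null, so dividing by \<open>l j\<close> is legitimate.\<close>
  have pos: "ws ! j \<bullet> ws ! j > 0" if "j < n" for j
  proof -
    have "ws ! j \<bullet> ws ! j \<ge> 0" by (auto simp: scalar_prod_def intro!: sum_nonneg)
    then show ?thesis using orth[OF that that] by linarith
  qed
  have "transpose_mat W * W = 1\<^sub>m n"
  proof (rule eq_matI)
    fix i j assume "i < dim_row (1\<^sub>m n :: real mat)" "j < dim_col (1\<^sub>m n :: real mat)"
    then have ij: "i < n" "j < n" by auto
    have "(transpose_mat W * W) $$ (i, j) = col W i \<bullet> col W j"
      using W ij by simp
    also have "\<dots> = (ws ! i \<bullet> ws ! j) / (l i * l j)"
      using wsc[OF ij(1)] wsc[OF ij(2)] by (simp add: colW ij)
    also have "\<dots> = 1\<^sub>m n $$ (i, j)"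
      using orth[OF ij] pos[OF ij(1)] ij by (auto simp: l_def)
    finally show "(transpose_mat W * W) $$ (i, j) = 1\<^sub>m n $$ (i, j)" .
  qed (use W in auto)
  with W colW[OF n] show ?thesis using that ws0 by metis
qed

text \<open>Deflation: in an orthonormal basis starting with an eigenvector, the first column of the
  matrix is a multiple of the first unit vector, and by symmetry so is the first row. The remaining
  block is again symmetric. Using the transpose as inverse witness of the similarity records that
  \<open>U\<close> is orthogonal.\<close>

lemma symmetric_mat_diagonalization:
  fixes S :: "real mat"
  assumes "S \<in> carrier_mat n n" and "transpose_mat S = S"
  shows "\<exists>U d. similar_mat_wit S (mat_diag n d) U (transpose_mat U)"
  using assms
proof (induction n arbitrary: S)
  case 0
  have "similar_mat_wit S (mat_diag 0 (\<lambda>_. 0)) (1\<^sub>m 0) (transpose_mat (1\<^sub>m 0))"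
    using 0 by (intro similar_mat_witI[of _ _ 0]) auto
  then show ?case by blast
next
  case (Suc n)
  note S = Suc.prems(1)
  obtain e v where v: "v \<in> carrier_vec (Suc n)" "v \<noteq> 0\<^sub>v (Suc n)" "S *\<^sub>v v = e \<cdot>\<^sub>v v"
    using symmetric_mat_has_eigenvalue[OF Suc.prems] S
    unfolding eigenvalue_def eigenvector_def by auto
  obtain W c where W: "W \<in> carrier_mat (Suc n) (Suc n)" "transpose_mat W * W = 1\<^sub>m (Suc n)"
      "col W 0 = c \<cdot>\<^sub>v v"
    using orthogonal_mat_with_first_col[OF v(1,2)] by metis
  have Wt: "transpose_mat W \<in> carrier_mat (Suc n) (Suc n)" using W(1) by simp
  have WWt: "W * transpose_mat W = 1\<^sub>m (Suc n)"
    using mat_mult_left_right_inverse[OF Wt W(1,2)] .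
  define T where "T = transpose_mat W * S * W"
  have T: "T \<in> carrier_mat (Suc n) (Suc n)" using S W(1) by (simp add: T_def)
  \<comment> \<open>\<open>T\<close> is defined from \<open>S\<close>, so the witness is built in
    the direction from \<open>T\<close> to \<open>S\<close> and then reversed.\<close>
  have simST: "similar_mat_wit S T W (transpose_mat W)"
  proof (rule similar_mat_wit_sym, rule similar_mat_witI[of _ _ "Suc n"])
    show "T = transpose_mat W * S * W" by (simp add: T_def)
  qed (use S W T WWt in auto)
  have symT: "transpose_mat T = T"
    using S W(1) Suc.prems(2) unfolding T_def
    by (simp add: transpose_mult[of _ "Suc n" "Suc n" _ "Suc n"] assoc_mult_mat[of _ "Suc n" "Suc n" _ "Suc n" _ "Suc n"])
  have T0: "T $$ (i, 0) = (if i = 0 then e else 0)" if "i < Suc n" for i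
  proof -
    have "T $$ (i, 0) = (transpose_mat W * (S * W)) $$ (i, 0)"
      using S W(1) unfolding T_def by (simp add: assoc_mult_mat[of _ "Suc n" "Suc n" _ "Suc n" _ "Suc n"])
    also have "\<dots> = col W i \<bullet> (S *\<^sub>v col W 0)"
      using S W(1) that unfolding col_mult2[OF S W(1) zero_less_Suc, symmetric]
      by (intro index_mult_mat(1)[THEN trans]) auto
    also have "S *\<^sub>v col W 0 = e \<cdot>\<^sub>v col W 0"
      using S v by (simp add: W(3) mult_mat_vec[OF S] smult_smult_assoc mult.commute)
    also have "col W i \<bullet> (e \<cdot>\<^sub>v col W 0) = e * (transpose_mat W * W) $$ (i, 0)"
      using W(1) that by simp
    also have "\<dots> = (if i = 0 then e else 0)"
      using that by (simp add: W(2))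
    finally show ?thesis .
  qed
  have T0': "T $$ (0, i) = (if i = 0 then e else 0)" if "i < Suc n" for i
    using T0[OF that] symT T that by (metis carrier_matD index_transpose_mat(1) zero_less_Suc)
  define R where "R = mat n n (\<lambda>(i, j). T $$ (Suc i, Suc j))"
  have R: "R \<in> carrier_mat n n" by (simp add: R_def)
  have symR: "transpose_mat R = R"
    using symT T by (intro eq_matI) (auto simp: R_def, metis Suc_less_eq carrier_matD index_transpose_mat(1))
  obtain U d where Ud: "similar_mat_wit R (mat_diag n d) U (transpose_mat U)"
    using Suc.IH[OF R symR] by blast
  note U = similar_mat_witD2[OF R Ud]
  \<comment> \<open>\<open>?b A x\<close> is block diagonal with blocks \<open>x\<close> and
    \<open>A\<close>. Such matrices multiply blockwise, so the diagonalization of \<open>R\<close>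
    extends to one of \<open>T\<close>.\<close>
  let ?b = "\<lambda>A x. four_block_mat (mat 1 1 (\<lambda>_. x)) (0\<^sub>m 1 n) (0\<^sub>m n 1) A"
  have bb: "?b A x * ?b B y = ?b (A * B) (x * y)"
    if "A \<in> carrier_mat n n" "B \<in> carrier_mat n n" for A B :: "real mat" and x y
  proof -
    have "mat 1 1 (\<lambda>_. x) * mat 1 1 (\<lambda>_. y) = mat 1 1 (\<lambda>_. x * y)"
      by (intro eq_matI) (auto simp: scalar_prod_def)
    with that show ?thesis
      by (subst mult_four_block_mat[of _ 1 1 _ n _ n]) auto
  qed
  have b1: "?b (1\<^sub>m n) 1 = 1\<^sub>m (Suc n)"
    by (intro eq_matI) auto
  have TR: "T = ?b R e"
    using T T0 T0' by (intro eq_matI) (auto simp: R_def)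
  \<comment> \<open>\<open>case_nat e d\<close> puts the split-off eigenvalue \<open>e\<close> in
    front of those of \<open>R\<close>.\<close>
  have D: "mat_diag (Suc n) (case_nat e d) = ?b (mat_diag n d) e"
    by (intro eq_matI) (auto simp: mat_diag_def split: nat.splits)
  have tU: "transpose_mat (?b U 1) = ?b (transpose_mat U) 1"
    using U by (subst transpose_four_block_mat[of _ 1 1 _ n _ n]) (auto)
  have bU: "?b U 1 \<in> carrier_mat (Suc n) (Suc n)"
    using U(6) by auto
  have "similar_mat_wit T (mat_diag (Suc n) (case_nat e d)) (?b U 1) (transpose_mat (?b U 1))"
    unfolding tU unfolding TR D
  proof (rule similar_mat_witI[of _ _ "Suc n"])
    show "?b U 1 * ?b (transpose_mat U) 1 = 1\<^sub>m (Suc n)"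
      unfolding bb[OF U(6,7)] U(1) mult_1_left b1 ..
    show "?b (transpose_mat U) 1 * ?b U 1 = 1\<^sub>m (Suc n)"
      unfolding bb[OF U(7,6)] U(2) mult_1_left b1 ..
    have UD: "U * mat_diag n d \<in> carrier_mat n n"
      using U(6) mat_diag_dim by (rule mult_carrier_mat)
    show "?b R e = ?b U 1 * ?b (mat_diag n d) e * ?b (transpose_mat U) 1"
      unfolding bb[OF U(6) mat_diag_dim] bb[OF UD U(7)] U(3) by simp
    show "?b (mat_diag n d) e \<in> carrier_mat (Suc n) (Suc n)"
      unfolding D[symmetric] by (rule mat_diag_dim)
  qed (use R U(4-7) in auto)
  from similar_mat_wit_trans[OF simST this]
  have "similar_mat_wit S (mat_diag (Suc n) (case_nat e d)) (W * ?b U 1)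
     (transpose_mat (W * ?b U 1))"
    unfolding transpose_mult[OF W(1) bU] .
  then show ?case by blast
qed

section \<open>Vector norms and polynomials of a symmetric matrix\<close>

lemma vec_l2_nonneg [simp]: "vec_l2 v \<ge> 0"
  by (simp add: vec_l2_def)

lemma vec_l2_smult [simp]: "vec_l2 (c \<cdot>\<^sub>v v) = \<bar>c\<bar> * vec_l2 v"
  by (simp add: vec_l2_def L2_set_def power_mult_distrib real_sqrt_mult flip: sum_distrib_left)

lemma vec_l2_eq_sqrt: "vec_l2 v = sqrt (v \<bullet> v)"
  by (simp add: vec_l2_def L2_set_def scalar_prod_def power2_eq_square atLeast0LessThan)

text \<open>Induction with the triangle inequality of \<open>L2_set\<close>. The sum is given entry
  by entry, so that it applies to columns of matrices without forming a finite sum of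
  vectors.\<close>

lemma vec_l2_sum_le:
  assumes "finite I" and "v \<in> carrier_vec n" and "\<And>f. f \<in> I \<Longrightarrow> y f \<in> carrier_vec n"
    and "\<And>i. i < n \<Longrightarrow> v $ i = (\<Sum>f\<in>I. y f $ i)"
  shows "vec_l2 v \<le> (\<Sum>f\<in>I. vec_l2 (y f))"
proof -
  have "L2_set (\<lambda>i. \<Sum>f\<in>I. y f $ i) {..<n} \<le> (\<Sum>f\<in>I. L2_set (\<lambda>i. y f $ i) {..<n})"
    using assms(1)
  proof (induction I rule: finite_induct)
    case (insert f I)
    then show ?case
      using L2_set_triangle_ineq[of "\<lambda>i. y f $ i" "\<lambda>i. \<Sum>f\<in>I. y f $ i" "{..<n}"] by simp
  qed (simp add: L2_set_def)
  moreover have "L2_set (\<lambda>i. y f $ i) {..<n} = vec_l2 (y f)" if "f \<in> I" for f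
    using assms(3)[OF that] by (simp add: vec_l2_def)
  moreover have "L2_set (\<lambda>i. \<Sum>f\<in>I. y f $ i) {..<n} = vec_l2 v"
    using assms(2,4) unfolding vec_l2_def by (intro L2_set_cong) auto
  ultimately show ?thesis by simp
qed

lemma vec_l2_add_le:
  assumes "v \<in> carrier_vec n" and "w \<in> carrier_vec n"
  shows "vec_l2 (v + w) \<le> vec_l2 v + vec_l2 w"
  using L2_set_triangle_ineq[of "\<lambda>i. v $ i" "\<lambda>i. w $ i" "{..<n}"] assms
  by (simp add: vec_l2_def L2_set_def)

section \<open>Frobenius norm, spectral norm and isometries\<close>

definition frobenius_norm :: "real mat \<Rightarrow> real" where
  "frobenius_norm A = L2_set (\<lambda>j. vec_l2 (col A j)) {..<dim_col A}"

text \<open>The product combines the columns of \<open>A\<close> with weights \<open>x $ j\<close>;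
  the triangle inequality and Cauchy-Schwarz finish.\<close>

lemma vec_l2_mult_le_frobenius:
  assumes "x \<in> carrier_vec (dim_col A)"
  shows "vec_l2 (A *\<^sub>v x) \<le> frobenius_norm A * vec_l2 x"
proof -
  have "vec_l2 (A *\<^sub>v x) \<le> (\<Sum>j<dim_col A. vec_l2 (x $ j \<cdot>\<^sub>v col A j))"
  proof (rule vec_l2_sum_le)
    fix i assume "i < dim_row A"
    then show "(A *\<^sub>v x) $ i = (\<Sum>j<dim_col A. (x $ j \<cdot>\<^sub>v col A j) $ i)"
      using assms by (simp add: scalar_prod_def atLeast0LessThan mult.commute)
  qed (auto intro!: carrier_vecI)
  also have "\<dots> = (\<Sum>j<dim_col A. \<bar>vec_l2 (col A j)\<bar> * \<bar>x $ j\<bar>)"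
    by (simp add: mult.commute)
  also have "\<dots> \<le> frobenius_norm A * vec_l2 x"
    using assms L2_set_mult_ineq[of "\<lambda>j. vec_l2 (col A j)" "\<lambda>j. x $ j" "{..<dim_col A}"]
    by (simp add: frobenius_norm_def vec_l2_def[of x])
  finally show ?thesis .
qed

text \<open>A real supremum bounds its set only if the set is bounded above; on the unit ball the
  Frobenius norm is such a bound.\<close>

lemma spectral_norm_bound:
  assumes x: "x \<in> carrier_vec (dim_col A)" "vec_l2 x \<le> 1"
  shows "vec_l2 (A *\<^sub>v x) \<le> spectral_norm A"
  unfolding spectral_norm_def
proof (rule cSUP_upper)
  have F: "frobenius_norm A \<ge> 0" by (simp add: frobenius_norm_def)
  show "bdd_above ((\<lambda>x. vec_l2 (A *\<^sub>v x)) ` {x \<in> carrier_vec (dim_col A). vec_l2 x \<le> 1})"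
  proof (intro bdd_aboveI2)
    fix x assume "x \<in> {x \<in> carrier_vec (dim_col A). vec_l2 x \<le> 1}"
    then show "vec_l2 (A *\<^sub>v x) \<le> frobenius_norm A"
      using vec_l2_mult_le_frobenius[of x A] mult_left_le[OF _ F, of "vec_l2 x"] by auto
  qed
qed (use x in auto)

lemma spectral_norm_nonneg [simp]: "spectral_norm A \<ge> 0"
proof -
  have "vec_l2 (0\<^sub>v (dim_col A)) = 0" by (simp add: vec_l2_def L2_set_def)
  then show ?thesis
    using spectral_norm_bound[of "0\<^sub>v (dim_col A)" A] vec_l2_nonneg
    by (metis order_trans zero_carrier_vec zero_le_one)
qed

lemma vec_l2_mult_le_spectral:
  assumes x: "x \<in> carrier_vec (dim_col A)"
  shows "vec_l2 (A *\<^sub>v x) \<le> spectral_norm A * vec_l2 x"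
proof (cases "vec_l2 x = 0")
  case True
  \<comment> \<open>A vector of length 0 cannot be rescaled to unit length; here the Frobenius bound
    makes the left side 0.\<close>
  then show ?thesis using vec_l2_mult_le_frobenius[OF x] by simp
next
  case False
  then have pos: "vec_l2 x > 0" using vec_l2_nonneg[of x] by linarith
  have "vec_l2 (A *\<^sub>v ((1 / vec_l2 x) \<cdot>\<^sub>v x)) \<le> spectral_norm A"
    using x pos by (intro spectral_norm_bound) auto
  also have "A *\<^sub>v ((1 / vec_l2 x) \<cdot>\<^sub>v x) = (1 / vec_l2 x) \<cdot>\<^sub>v (A *\<^sub>v x)"
    using x by (intro mult_mat_vec) auto
  finally show ?thesis using pos by (simp add: field_simps)
qed

lemma vec_l2_orthogonal_mult:
  assumes U: "U \<in> carrier_mat m n" "transpose_mat U * U = 1\<^sub>m n" and x: "x \<in> carrier_vec n"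
  shows "vec_l2 (U *\<^sub>v x) = vec_l2 x"
proof -
  have "(U *\<^sub>v x) \<bullet> (U *\<^sub>v x) = (transpose_mat U *\<^sub>v (U *\<^sub>v x)) \<bullet> x"
    using transpose_vec_mult_scalar[OF U(1) x, of "U *\<^sub>v x"] U x by simp
  also have "transpose_mat U *\<^sub>v (U *\<^sub>v x) = (transpose_mat U * U) *\<^sub>v x"
    using U(1) x by (intro assoc_mult_mat_vec[symmetric]) auto
  finally show ?thesis using x by (simp add: vec_l2_eq_sqrt U(2))
qed

section \<open>Polynomials of a diagonalized matrix\<close>

definition mat_poly :: "nat \<Rightarrow> (nat \<Rightarrow> real) \<Rightarrow> real mat \<Rightarrow> real mat" where
  "mat_poly K a S = mat (dim_row S) (dim_row S) (\<lambda>ij. \<Sum>k\<le>K. a k * (S ^\<^sub>m k) $$ ij)"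

lemma pow_mat_diag: "mat_diag n d ^\<^sub>m k = mat_diag n (\<lambda>i. d i ^ k :: real)"
proof (induction k)
  case 0
  show ?case by (simp add: mat_diag_def)
next
  case (Suc k)
  then show ?case by (simp add: mult.commute)
qed

lemma mult_mat_diag_index:
  assumes "U \<in> carrier_mat n n" "Q \<in> carrier_mat n n" "i < n" "j < n"
  shows "(U * mat_diag n f * Q) $$ (i, j) = (\<Sum>l<n. U $$ (i, l) * f l * Q $$ (l, j))"
  using assms by (simp add: mat_diag_mult_right[of _ n] scalar_prod_def atLeast0LessThan)

text \<open>All powers of \<open>S\<close> are powers of the diagonal matrix conjugated by the same
  \<open>U\<close> and \<open>Q\<close>, so the polynomial acts on the diagonal entries
  alone.\<close>

lemma mat_poly_similar_diag:
  assumes S: "S \<in> carrier_mat n n" and sim: "similar_mat_wit S (mat_diag n d) U Q"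
  shows "mat_poly K a S = U * mat_diag n (\<lambda>i. \<Sum>k\<le>K. a k * d i ^ k) * Q"
proof (rule eq_matI)
  note w = similar_mat_witD2[OF S sim]
  let ?R = "U * mat_diag n (\<lambda>i. \<Sum>k\<le>K. a k * d i ^ k) * Q"
  fix i j assume "i < dim_row ?R" "j < dim_col ?R"
  then have ij: "i < n" "j < n" using w by auto
  have "mat_poly K a S $$ (i, j) = (\<Sum>k\<le>K. a k * (\<Sum>l<n. U $$ (i, l) * d l ^ k * Q $$ (l, j)))"
    using S ij by (simp add: mat_poly_def similar_mat_wit_pow_id[OF sim] pow_mat_diag
      mult_mat_diag_index[OF w(6,7) ij])
  also have "\<dots> = (\<Sum>l<n. \<Sum>k\<le>K. a k * (U $$ (i, l) * d l ^ k * Q $$ (l, j)))"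
    by (subst sum.swap) (simp add: sum_distrib_left)
  also have "\<dots> = ?R $$ (i, j)"
    by (simp add: mult_mat_diag_index[OF w(6,7) ij] sum_distrib_left sum_distrib_right mult_ac)
  finally show "mat_poly K a S $$ (i, j) = ?R $$ (i, j)" .
qed (use similar_mat_witD2[OF S sim] in \<open>auto simp: mat_poly_def\<close>)

text \<open>This makes \<open>spectrum_in\<close> applicable to the diagonal entries. Similar
  matrices share their characteristic polynomial, and that of a diagonal matrix has the roots
  \<open>d i\<close>.\<close>

lemma eigenvalue_similar_diag:
  assumes S: "S \<in> carrier_mat n n" and sim: "similar_mat_wit S (mat_diag n d) U Q" and i: "i < n"
  shows "eigenvalue S (d i :: real)"
proof -
  have "char_poly S = char_poly (mat_diag n d)"
    using sim by (intro char_poly_similar) (auto simp: similar_mat_def)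
  also have "\<dots> = (\<Prod>a\<leftarrow>diag_mat (mat_diag n d). [:- a, 1:])"
    by (rule char_poly_upper_triangular[of _ n]) (auto simp: mat_diag_def)
  also have "poly \<dots> (d i) = 0"
    using i by (auto simp: poly_prod_list diag_mat_def mat_diag_def image_iff)
  finally show ?thesis using eigenvalue_root_char_poly[OF S] by simp
qed

lemma vec_l2_mat_diag_le:
  assumes "x \<in> carrier_vec n" and "\<And>i. i < n \<Longrightarrow> \<bar>f i\<bar> \<le> c" and "c \<ge> 0"
  shows "vec_l2 (mat_diag n f *\<^sub>v x) \<le> c * vec_l2 x"
proof -
  have e: "(mat_diag n f *\<^sub>v x) $ i = f i * x $ i" if "i < n" for i
  proof -
    have "(mat_diag n f *\<^sub>v x) $ i = (\<Sum>j<n. (if i = j then f j else 0) * x $ j)"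
      using assms(1) that by (simp add: mat_diag_def scalar_prod_def atLeast0LessThan)
    also have "\<dots> = (\<Sum>j<n. if i = j then f j * x $ j else 0)"
      by (intro sum.cong) auto
    finally show ?thesis using that by simp
  qed
  have "vec_l2 (mat_diag n f *\<^sub>v x) = L2_set (\<lambda>i. \<bar>f i * x $ i\<bar>) {..<n}"
    using assms(1) e by (auto simp: vec_l2_def L2_set_def mat_diag_def)
  also have "\<dots> \<le> L2_set (\<lambda>i. c * \<bar>x $ i\<bar>) {..<n}"
    using assms(2) by (intro L2_set_mono) (auto simp: abs_mult intro!: mult_right_mono)
  also have "\<dots> = c * vec_l2 x"
    using assms(1,3) by (simp add: vec_l2_def flip: L2_set_right_distrib) (simp add: L2_set_def)
  finally show ?thesis .
qed

text \<open>Orthogonal changes of basis preserve length, so only the diagonal factor counts. Its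
  entries are values of the polynomial at eigenvalues, all in \<open>{lo..hi}\<close>.\<close>

lemma mat_poly_norm_le:
  assumes S: "S \<in> carrier_mat n n" "transpose_mat S = S" and spec: "spectrum_in S lo hi"
    and a: "\<And>y. y \<in> {lo..hi} \<Longrightarrow> \<bar>\<Sum>k\<le>K. a k * y ^ k\<bar> \<le> c" and c: "c \<ge> 0"
    and x: "x \<in> carrier_vec n"
  shows "vec_l2 (mat_poly K a S *\<^sub>v x) \<le> c * vec_l2 x"
proof -
  obtain U d where Ud: "similar_mat_wit S (mat_diag n d) U (transpose_mat U)"
    using symmetric_mat_diagonalization[OF S] by blast
  note U = similar_mat_witD2[OF S(1) Ud]
  let ?D = "mat_diag n (\<lambda>i. \<Sum>k\<le>K. a k * d i ^ k)"
  have Ux: "transpose_mat U *\<^sub>v x \<in> carrier_vec n" using U x by simp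
  have "mat_poly K a S *\<^sub>v x = U *\<^sub>v (?D *\<^sub>v (transpose_mat U *\<^sub>v x))"
    unfolding mat_poly_similar_diag[OF S(1) Ud] using U(6,7) x
    by (simp add: assoc_mult_mat_vec[of _ n n _ n] mult_carrier_mat[OF U(6) mat_diag_dim])
  then have "vec_l2 (mat_poly K a S *\<^sub>v x) = vec_l2 (?D *\<^sub>v (transpose_mat U *\<^sub>v x))"
    using vec_l2_orthogonal_mult[OF U(6,2)] Ux by (simp add: mult_mat_vec_carrier[OF mat_diag_dim])
  also have "\<dots> \<le> c * vec_l2 (transpose_mat U *\<^sub>v x)"
    using eigenvalue_similar_diag[OF S(1) Ud] spec
    by (intro vec_l2_mat_diag_le Ux a c) (auto simp: spectrum_in_def)
  also have "\<dots> = c * vec_l2 x"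
    using vec_l2_orthogonal_mult[OF U(7) _ x] U(1) by simp
  finally show ?thesis .
qed

text \<open>Taking the eigenbasis of one matrix on the left and of the other on the right reduces
  the difference to \<open>F W - W G\<close> with \<open>W = U^T V\<close> and diagonal
  \<open>F\<close>, \<open>G\<close>, even if the two matrices do not commute.\<close>

lemma orthogonal_conj_diff_index:
  fixes U V :: "real mat"
  assumes U: "U \<in> carrier_mat n n" "transpose_mat U * U = 1\<^sub>m n"
    and V: "V \<in> carrier_mat n n" "transpose_mat V * V = 1\<^sub>m n" and ij: "i < n" "j < n"
  shows "(transpose_mat U * (U * mat_diag n f * transpose_mat U - V * mat_diag n g * transpose_mat V) * V) $$ (i, j)
    = (f i - g j) * (transpose_mat U * V) $$ (i, j)"
proof -
  let ?U = "transpose_mat U" and ?V = "transpose_mat V"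
  let ?F = "mat_diag n f" and ?G = "mat_diag n g"
  note C = U(1) V(1) mat_diag_dim[of n f] mat_diag_dim[of n g]
  have C': "?U \<in> carrier_mat n n" "?V \<in> carrier_mat n n" using U V by auto
  note assoc = assoc_mult_mat[of _ n n _ n _ n] and carr = mult_carrier_mat[of _ n n _ n]
  have X: "U * ?F * ?U \<in> carrier_mat n n" and Y: "V * ?G * ?V \<in> carrier_mat n n"
    using C C' by (auto intro!: carr)
  have "?U * (U * ?F * ?U - V * ?G * ?V) * V = ?U * (U * ?F * ?U) * V - ?U * (V * ?G * ?V) * V"
    unfolding mult_minus_distrib_mat[OF C'(1) X Y]
    by (rule minus_mult_distrib_mat[OF carr[OF C'(1) X] carr[OF C'(1) Y] V(1)])
  also have "\<dots> = (?U * U) * ?F * (?U * V) - (?U * V) * ?G * (?V * V)"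
  proof (rule arg_cong2[of _ _ _ _ "(-)"])
    show "?U * (U * ?F * ?U) * V = (?U * U) * ?F * (?U * V)"
      using C C' by (simp add: assoc carr)
    show "?U * (V * ?G * ?V) * V = (?U * V) * ?G * (?V * V)"
      using C C' by (simp add: assoc carr)
  qed
  also have "\<dots> = ?F * (?U * V) - (?U * V) * ?G"
    using C C' unfolding U(2) V(2)
    by (simp add: left_mult_one_mat[of _ n n] right_mult_one_mat[of _ n n] mult_carrier_mat[of _ n n _ n])
  also have "\<dots> $$ (i, j) = (f i - g j) * (?U * V) $$ (i, j)"
  proof -
    define W where "W = ?U * V"
    have W: "W \<in> carrier_mat n n" unfolding W_def by (rule carr[OF C'(1) V(1)])
    show ?thesis
      unfolding W_def[symmetric] mat_diag_mult_left[OF W] mat_diag_mult_right[OF W]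
      using ij by (simp add: left_diff_distrib mult.commute)
  qed
  finally show ?thesis .
qed

text \<open>The polynomial difference and \<open>S - T\<close> acquire the same entrywise factor
  from \<open>U^T V\<close>, so the scalar Lipschitz bound transfers entry by entry. Entrywise
  domination is respected by the Frobenius norm but not by the spectral norm; the detour costs
  \<open>sqrt n\<close>.\<close>

lemma mat_poly_diff_le:
  assumes S: "S \<in> carrier_mat n n" "transpose_mat S = S" "spectrum_in S lo hi"
    and T: "T \<in> carrier_mat n n" "transpose_mat T = T" "spectrum_in T lo hi"
    and a: "\<And>y z. y \<in> {lo..hi} \<Longrightarrow> z \<in> {lo..hi} \<Longrightarrow>
      \<bar>(\<Sum>k\<le>K. a k * y ^ k) - (\<Sum>k\<le>K. a k * z ^ k)\<bar> \<le> \<gamma> * \<bar>y - z\<bar>"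
    and \<gamma>: "\<gamma> \<ge> 0" and x: "x \<in> carrier_vec n"
  shows "vec_l2 ((mat_poly K a S - mat_poly K a T) *\<^sub>v x)
    \<le> \<gamma> * (sqrt n * spectral_norm (S - T)) * vec_l2 x"
proof -
  obtain U d where Ud: "similar_mat_wit S (mat_diag n d) U (transpose_mat U)"
    using symmetric_mat_diagonalization[OF S(1,2)] by blast
  note U = similar_mat_witD2[OF S(1) Ud]
  obtain V e where Ve: "similar_mat_wit T (mat_diag n e) V (transpose_mat V)"
    using symmetric_mat_diagonalization[OF T(1,2)] by blast
  note V = similar_mat_witD2[OF T(1) Ve]
  let ?p = "\<lambda>y. \<Sum>k\<le>K. a k * y ^ k"
  let ?U = "transpose_mat U" and ?V = "transpose_mat V"
  define M where "M = mat_poly K a S - mat_poly K a T"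
  define P where "P = ?U * M * V"
  define R where "R = ?U * (S - T) * V"
  have M: "M \<in> carrier_mat n n" using S(1) T(1) unfolding M_def mat_poly_def by (intro minus_carrier_mat) auto
  have P: "P \<in> carrier_mat n n"
    unfolding P_def by (intro mult_carrier_mat[of _ n n _ n] U V M)
  have R: "R \<in> carrier_mat n n"
    unfolding R_def by (intro mult_carrier_mat[of _ n n _ n] minus_carrier_mat U(7) V(6) T(1))
  have ST: "S - T \<in> carrier_mat n n"
    using T(1) by (rule minus_carrier_mat)
  have PR: "\<bar>P $$ (i, j)\<bar> \<le> \<gamma> * \<bar>R $$ (i, j)\<bar>" if ij: "i < n" "j < n" for i j
  proof -
    have "P $$ (i, j) = (?p (d i) - ?p (e j)) * (?U * V) $$ (i, j)"
      unfolding P_def M_def mat_poly_similar_diag[OF S(1) Ud] mat_poly_similar_diag[OF T(1) Ve]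
      by (rule orthogonal_conj_diff_index[OF U(6,2) V(6,2) ij])
    \<comment> \<open>The same entry formula, after replacing \<open>S\<close> and \<open>T\<close>
      by their diagonalizations.\<close>
    moreover have "R $$ (i, j) = (d i - e j) * (?U * V) $$ (i, j)"
      unfolding R_def by (subst U(3), subst V(3), rule orthogonal_conj_diff_index[OF U(6,2) V(6,2) ij])
    moreover have "\<bar>?p (d i) - ?p (e j)\<bar> \<le> \<gamma> * \<bar>d i - e j\<bar>"
      using eigenvalue_similar_diag[OF S(1) Ud ij(1)] eigenvalue_similar_diag[OF T(1) Ve ij(2)] S(3) T(3)
      by (intro a) (auto simp: spectrum_in_def)
    ultimately show ?thesis
      by (simp add: abs_mult mult_right_mono flip: mult.assoc)
  qed
  have colP: "vec_l2 (col P j) \<le> \<gamma> * spectral_norm (S - T)" if j: "j < n" for j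
  proof -
    have "vec_l2 (col P j) = L2_set (\<lambda>i. \<bar>P $$ (i, j)\<bar>) {..<n}"
      using P j by (auto simp: vec_l2_def L2_set_def)
    also have "\<dots> \<le> L2_set (\<lambda>i. \<gamma> * \<bar>R $$ (i, j)\<bar>) {..<n}"
      using PR j by (intro L2_set_mono) auto
    also have "\<dots> = \<gamma> * vec_l2 (col R j)"
      using R j \<gamma> by (auto simp: vec_l2_def L2_set_def power_mult_distrib real_sqrt_mult simp flip: sum_distrib_left)
    also have "col R j = ?U *\<^sub>v ((S - T) *\<^sub>v col V j)"
      using j unfolding R_def assoc_mult_mat[OF U(7) ST V(6)]
      by (simp only: col_mult2[OF U(7) mult_carrier_mat[OF ST V(6)]] col_mult2[OF ST V(6)])
    also have "vec_l2 \<dots> = vec_l2 ((S - T) *\<^sub>v col V j)"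
      using U(1) j V(6) by (intro vec_l2_orthogonal_mult[OF U(7)] mult_mat_vec_carrier[OF ST]) auto
    also have "\<dots> \<le> spectral_norm (S - T) * vec_l2 (col V j)"
      using S(1) T(1) j V(6) by (intro vec_l2_mult_le_spectral) auto
    \<comment> \<open>As the image of a unit vector under an isometry, the column has length
      1.\<close>
    also have "col V j = V *\<^sub>v unit_vec n j"
      using V(6) j by (intro eq_vecI) auto
    also have "vec_l2 \<dots> = 1"
      using vec_l2_orthogonal_mult[OF V(6,2) unit_vec_carrier] j by (simp add: vec_l2_eq_sqrt)
    finally show ?thesis using \<gamma> by (simp add: mult_left_mono)
  qed
  \<comment> \<open>There are \<open>n\<close> columns, each bounded by \<open>colP\<close>; this is
    the source of the factor \<open>sqrt n\<close>.\<close>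
  have "frobenius_norm P \<le> L2_set (\<lambda>_. \<gamma> * spectral_norm (S - T)) {..<n}"
    unfolding frobenius_norm_def using P colP by (auto intro!: L2_set_mono)
  also have "\<dots> = \<gamma> * (sqrt n * spectral_norm (S - T))"
    using \<gamma> by (simp add: L2_set_def real_sqrt_mult)
  finally have frobP: "frobenius_norm P \<le> \<gamma> * (sqrt n * spectral_norm (S - T))" .
  have Vx: "?V *\<^sub>v x \<in> carrier_vec n" using V x by simp
  have "V *\<^sub>v (?V *\<^sub>v x) = x"
    using assoc_mult_mat_vec[OF V(6,7) x] V(1) x by simp
  \<comment> \<open>Evaluating \<open>P\<close> at \<open>V^T x\<close> cancels \<open>V\<close>;
    the factor \<open>U^T\<close> left over is an isometry.\<close>
  then have PM: "P *\<^sub>v (?V *\<^sub>v x) = ?U *\<^sub>v (M *\<^sub>v x)"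
    unfolding P_def assoc_mult_mat_vec[OF mult_carrier_mat[OF U(7) M] V(6) Vx]
      assoc_mult_mat_vec[OF U(7) M mult_mat_vec_carrier[OF V(6) Vx]] by simp
  have "vec_l2 (M *\<^sub>v x) = vec_l2 (P *\<^sub>v (?V *\<^sub>v x))"
    unfolding PM using U(1) by (intro vec_l2_orthogonal_mult[OF U(7), symmetric] mult_mat_vec_carrier[OF M x]) auto
  also have "\<dots> \<le> frobenius_norm P * vec_l2 (?V *\<^sub>v x)"
    using P Vx by (intro vec_l2_mult_le_frobenius) auto
  also have "vec_l2 (?V *\<^sub>v x) = vec_l2 x"
    using V(1,7) x by (intro vec_l2_orthogonal_mult[of _ n n]) auto
  also have "frobenius_norm P * vec_l2 x \<le> \<gamma> * (sqrt n * spectral_norm (S - T)) * vec_l2 x"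
    using frobP by (rule mult_right_mono) simp
  finally show ?thesis unfolding M_def .
qed

section \<open>Signal norms and graph filters\<close>

lemma row_sum_le_row_sum_norm:
  assumes "i < dim_row A"
  shows "(\<Sum>j<dim_col A. \<bar>A $$ (i, j)\<bar>) \<le> row_sum_norm A"
  unfolding row_sum_norm_def using assms by (intro Max_ge) auto

text \<open>\<open>Max\<close> has no specified value on the empty set, so a row must exist. This is
  why positive feature counts are carried along below.\<close>

lemma row_sum_norm_nonneg:
  assumes "dim_row A > 0"
  shows "row_sum_norm A \<ge> 0"
  using row_sum_le_row_sum_norm[OF assms] by (rule order_trans[rotated]) (simp add: sum_nonneg)

lemma signal_norm_nonneg [simp]: "signal_norm X \<ge> 0"
  by (simp add: signal_norm_def sum_nonneg)

lemma signal_norm_add_le: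
  assumes X: "X \<in> carrier_mat n m" and Y: "Y \<in> carrier_mat n m"
  shows "signal_norm (X + Y) \<le> signal_norm X + signal_norm Y"
proof -
  have "signal_norm (X + Y) = (\<Sum>f<m. vec_l2 (col X f + col Y f))"
    using X Y by (simp add: signal_norm_def)
  also have "\<dots> \<le> (\<Sum>f<m. vec_l2 (col X f) + vec_l2 (col Y f))"
    using X Y by (intro sum_mono vec_l2_add_le[of _ n]) auto
  also have "\<dots> = signal_norm X + signal_norm Y"
    using X Y by (simp add: signal_norm_def sum.distrib)
  finally show ?thesis .
qed

lemma signal_norm_triangle:
  assumes "X \<in> carrier_mat n m" and "Y \<in> carrier_mat n m" and "Z \<in> carrier_mat n m"
  shows "signal_norm (X - Z) \<le> signal_norm (X - Y) + signal_norm (Y - Z)"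
proof -
  have "X - Z = (X - Y) + (Y - Z)"
    using assms by (intro eq_matI) auto
  then show ?thesis
    using signal_norm_add_le[of "X - Y" n m "Y - Z"] assms by (simp add: minus_carrier_mat)
qed

text \<open>Column norms are monotone in the absolute values of the entries; through this the scalar
  Lipschitz bound on \<open>\<sigma>\<close> reaches signals.\<close>

lemma signal_norm_mono:
  assumes X: "X \<in> carrier_mat n m" and Y: "Y \<in> carrier_mat n m"
    and le: "\<And>i j. i < n \<Longrightarrow> j < m \<Longrightarrow> \<bar>X $$ (i, j)\<bar> \<le> \<bar>Y $$ (i, j)\<bar>"
  shows "signal_norm X \<le> signal_norm Y"
proof -
  have "vec_l2 (col X f) \<le> vec_l2 (col Y f)" if "f < m" for f
    using X Y that le unfolding vec_l2_def L2_set_def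
    by (auto intro!: sum_mono real_sqrt_le_mono simp: abs_le_square_iff)
  then show ?thesis
    using X Y by (auto simp: signal_norm_def intro!: sum_mono)
qed

lemma signal_norm_diff_le:
  assumes X: "X \<in> carrier_mat n m" and Y: "Y \<in> carrier_mat n m"
  shows "signal_norm (X - Y) \<le> signal_norm X + signal_norm Y"
proof -
  have "X - Y = X + (- Y)"
    using X Y by (intro eq_matI) auto
  moreover have "signal_norm (- Y) \<le> signal_norm Y"
    using Y by (intro signal_norm_mono) auto
  ultimately show ?thesis
    using signal_norm_add_le[OF X, of "- Y"] Y by simp
qed

text \<open>Common core of right multiplication, filtering and filter perturbation: output feature
  \<open>g\<close> collects a share \<open>y f g\<close> from every input feature \<open>f\<close>.
  Summing over \<open>g\<close> first leaves \<open>z f\<close> weighted by the absolute row sum of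
  row \<open>f\<close> of \<open>c\<close>.\<close>

lemma signal_norm_mix_le:
  assumes Y: "Y \<in> carrier_mat n G" and c: "c \<in> carrier_mat F G"
    and y: "\<And>f g. f < F \<Longrightarrow> g < G \<Longrightarrow> y f g \<in> carrier_vec n"
    and Yy: "\<And>i g. i < n \<Longrightarrow> g < G \<Longrightarrow> Y $$ (i, g) = (\<Sum>f<F. y f g $ i)"
    and le: "\<And>f g. f < F \<Longrightarrow> g < G \<Longrightarrow> vec_l2 (y f g) \<le> \<bar>c $$ (f, g)\<bar> * z f"
    and z: "\<And>f. f < F \<Longrightarrow> z f \<ge> 0"
  shows "signal_norm Y \<le> row_sum_norm c * (\<Sum>f<F. z f)"
proof -
  have "signal_norm Y \<le> (\<Sum>g<G. \<Sum>f<F. \<bar>c $$ (f, g)\<bar> * z f)"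
  proof -
    have "vec_l2 (col Y g) \<le> (\<Sum>f<F. \<bar>c $$ (f, g)\<bar> * z f)" if g: "g < G" for g
    proof -
      have "vec_l2 (col Y g) \<le> (\<Sum>f<F. vec_l2 (y f g))"
        using Y y Yy g by (intro vec_l2_sum_le[of _ _ n]) (auto intro!: carrier_vecI)
      also have "\<dots> \<le> (\<Sum>f<F. \<bar>c $$ (f, g)\<bar> * z f)"
        using le g by (intro sum_mono) auto
      finally show ?thesis .
    qed
    then show ?thesis
      using Y by (auto simp: signal_norm_def intro!: sum_mono)
  qed
  also have "\<dots> = (\<Sum>f<F. (\<Sum>g<G. \<bar>c $$ (f, g)\<bar>) * z f)"
    by (subst sum.swap) (simp add: sum_distrib_right)
  also have "\<dots> \<le> (\<Sum>f<F. row_sum_norm c * z f)"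
    using row_sum_le_row_sum_norm[of _ c] c z by (intro sum_mono mult_right_mono) auto
  finally show ?thesis by (simp add: sum_distrib_left)
qed

lemma signal_norm_mult_right_le:
  assumes X: "X \<in> carrier_mat n F" and A: "A \<in> carrier_mat F G"
  shows "signal_norm (X * A) \<le> row_sum_norm A * signal_norm X"
proof -
  have "signal_norm (X * A) \<le> row_sum_norm A * (\<Sum>f<F. vec_l2 (col X f))"
    using X A
    by (intro signal_norm_mix_le[where n = n and G = G and y = "\<lambda>f g. A $$ (f, g) \<cdot>\<^sub>v col X f"])
      (auto simp: scalar_prod_def atLeast0LessThan mult.commute)
  then show ?thesis using X by (simp add: signal_norm_def)
qed

lemma signal_norm_mult_left_le:
  assumes X: "X \<in> carrier_mat n F" and A: "A \<in> carrier_mat m n"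
  shows "signal_norm (A * X) \<le> spectral_norm A * signal_norm X"
proof -
  have "vec_l2 (col (A * X) f) \<le> spectral_norm A * vec_l2 (col X f)" if "f < F" for f
    unfolding col_mult2[OF A X that] using X A by (intro vec_l2_mult_le_spectral) auto
  then show ?thesis
    using X by (auto simp: signal_norm_def sum_distrib_left intro!: sum_mono)
qed

lemma signal_norm_sandwich_le:
  assumes P: "P \<in> carrier_mat n n" and Y: "Y \<in> carrier_mat n m" and Q: "Q \<in> carrier_mat m F"
    and m: "m > 0"
  shows "signal_norm (P * Y * Q) \<le> spectral_norm P * row_sum_norm Q * signal_norm Y"
proof -
  have "signal_norm (P * Y * Q) \<le> row_sum_norm Q * signal_norm (P * Y)"
    using P Y Q by (intro signal_norm_mult_right_le) auto
  also have "\<dots> \<le> row_sum_norm Q * (spectral_norm P * signal_norm Y)"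
    using signal_norm_mult_left_le[OF Y P] row_sum_norm_nonneg[of Q] Q m
    by (intro mult_left_mono) auto
  finally show ?thesis by (simp add: mult_ac)
qed

text \<open>The factors are exchanged one at a time: first \<open>Q\<close>, then \<open>P\<close>,
  last \<open>Y\<close>. This order puts the unperturbed \<open>P\<close> and the perturbed
  \<open>Qh\<close> into the coefficient of \<open>\<epsilon>\<close>, and only perturbed matrices
  into that of the state error, as in \<open>C_xi_hat\<close> and the stability constant of the
  perturbed system.\<close>

lemma signal_norm_sandwich_diff_le:
  assumes P: "P \<in> carrier_mat n n" and Ph: "Ph \<in> carrier_mat n n"
    and Y: "Y \<in> carrier_mat n m" and Yh: "Yh \<in> carrier_mat n m"
    and Q: "Q \<in> carrier_mat m F" and Qh: "Qh \<in> carrier_mat m F" and m: "m > 0"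
    and \<epsilon>P: "spectral_norm (P - Ph) \<le> \<epsilon>" and \<epsilon>Q: "row_sum_norm (Q - Qh) \<le> \<epsilon>"
  shows "signal_norm (P * Y * Q - Ph * Yh * Qh)
    \<le> (spectral_norm P + row_sum_norm Qh) * \<epsilon> * signal_norm Y
      + spectral_norm Ph * row_sum_norm Qh * signal_norm (Y - Yh)"
proof -
  have dP: "P - Ph \<in> carrier_mat n n" using Ph by (rule minus_carrier_mat)
  have dQ: "Q - Qh \<in> carrier_mat m F" using Qh by (rule minus_carrier_mat)
  have dY: "Y - Yh \<in> carrier_mat n m" using Yh by (rule minus_carrier_mat)
  have nonneg: "row_sum_norm (Q - Qh) \<ge> 0" "row_sum_norm Qh \<ge> 0"
    using dQ Qh m by (auto intro!: row_sum_norm_nonneg)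
  note c = mult_carrier_mat[OF mult_carrier_mat]
  have "signal_norm (P * Y * Q - Ph * Yh * Qh)
      \<le> signal_norm (P * Y * Q - P * Y * Qh) + signal_norm (P * Y * Qh - Ph * Yh * Qh)"
    by (rule signal_norm_triangle[OF c[OF P Y Q] c[OF P Y Qh] c[OF Ph Yh Qh]])
  also have "signal_norm (P * Y * Qh - Ph * Yh * Qh)
      \<le> signal_norm (P * Y * Qh - Ph * Y * Qh) + signal_norm (Ph * Y * Qh - Ph * Yh * Qh)"
    by (rule signal_norm_triangle[OF c[OF P Y Qh] c[OF Ph Y Qh] c[OF Ph Yh Qh]])
  also have "P * Y * Q - P * Y * Qh = P * Y * (Q - Qh)"
    by (rule mult_minus_distrib_mat[OF mult_carrier_mat[OF P Y] Q Qh, symmetric])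
  also have "P * Y * Qh - Ph * Y * Qh = (P - Ph) * Y * Qh"
    unfolding minus_mult_distrib_mat[OF P Ph Y]
    by (rule minus_mult_distrib_mat[OF mult_carrier_mat[OF P Y] mult_carrier_mat[OF Ph Y] Qh, symmetric])
  also have "Ph * Y * Qh - Ph * Yh * Qh = Ph * (Y - Yh) * Qh"
    unfolding mult_minus_distrib_mat[OF Ph Y Yh]
    by (rule minus_mult_distrib_mat[OF mult_carrier_mat[OF Ph Y] mult_carrier_mat[OF Ph Yh] Qh, symmetric])
  also have "signal_norm (P * Y * (Q - Qh)) \<le> spectral_norm P * \<epsilon> * signal_norm Y"
    by (rule order_trans[OF signal_norm_sandwich_le[OF P Y dQ m]])
      (intro mult_right_mono mult_left_mono \<epsilon>Q; simp)
  also have "signal_norm ((P - Ph) * Y * Qh) \<le> \<epsilon> * row_sum_norm Qh * signal_norm Y"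
    by (rule order_trans[OF signal_norm_sandwich_le[OF dP Y Qh m]])
      (intro mult_right_mono \<epsilon>P; simp add: nonneg)
  also have "signal_norm (Ph * (Y - Yh) * Qh) \<le> spectral_norm Ph * row_sum_norm Qh * signal_norm (Y - Yh)"
    by (rule signal_norm_sandwich_le[OF Ph dY Qh m])
  finally show ?thesis by (simp add: algebra_simps)
qed

section \<open>Graph filters on symmetric supports\<close>

definition admissible_support :: "nat \<Rightarrow> real \<Rightarrow> real \<Rightarrow> real mat \<Rightarrow> bool" where
  "admissible_support n lo hi S \<longleftrightarrow>
     S \<in> carrier_mat n n \<and> transpose_mat S = S \<and> spectrum_in S lo hi"

lemma graph_filter_carrier [simp]:
  assumes "X \<in> carrier_mat n F" and "H 0 \<in> carrier_mat F G"
  shows "graph_filter K H S X \<in> carrier_mat n G"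
  using assms by (simp add: graph_filter_def)

text \<open>Reordering the sums so that the one over taps is innermost turns the filter into a bank
  of scalar polynomials of \<open>S\<close>, one for each pair of features.\<close>

lemma graph_filter_index:
  assumes X: "X \<in> carrier_mat n F" and H: "\<And>k. k \<le> K \<Longrightarrow> H k \<in> carrier_mat F G"
    and S: "S \<in> carrier_mat n n" and ig: "i < n" "g < G"
  shows "graph_filter K H S X $$ (i, g)
    = (\<Sum>f<F. (mat_poly K (\<lambda>k. H k $$ (f, g)) S *\<^sub>v col X f) $ i)"
proof -
  have "(S ^\<^sub>m k * X * H k) $$ (i, g) = (\<Sum>f<F. (\<Sum>j<n. (S ^\<^sub>m k) $$ (i, j) * X $$ (j, f)) * H k $$ (f, g))"
    if "k \<le> K" for k
    using X H[OF that] S ig by (simp add: scalar_prod_def atLeast0LessThan)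
  then have "graph_filter K H S X $$ (i, g)
      = (\<Sum>k\<le>K. \<Sum>f<F. (\<Sum>j<n. (S ^\<^sub>m k) $$ (i, j) * X $$ (j, f)) * H k $$ (f, g))"
    using X H[of 0] ig by (simp add: graph_filter_def)
  also have "\<dots> = (\<Sum>f<F. \<Sum>k\<le>K. \<Sum>j<n. (S ^\<^sub>m k) $$ (i, j) * X $$ (j, f) * H k $$ (f, g))"
    by (subst sum.swap) (simp add: sum_distrib_right)
  also have "\<dots> = (\<Sum>f<F. \<Sum>j<n. \<Sum>k\<le>K. (S ^\<^sub>m k) $$ (i, j) * X $$ (j, f) * H k $$ (f, g))"
    by (subst (2) sum.swap) simp
  also have "\<dots> = (\<Sum>f<F. (mat_poly K (\<lambda>k. H k $$ (f, g)) S *\<^sub>v col X f) $ i)"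
    using X S ig by (simp add: mat_poly_def scalar_prod_def atLeast0LessThan sum_distrib_right sum_distrib_left mult_ac)
  finally show ?thesis .
qed

text \<open>The filter size is built from suprema, so boundedness is required: on
  \<open>{lo..hi}\<close> each power is dominated by that of \<open>|lo| + |hi|\<close>.\<close>

lemma abs_freq_response_le:
  assumes x: "x \<in> {lo..hi}"
  shows "\<bar>freq_response K H f g x\<bar> \<le> (SUP x\<in>{lo..hi}. \<bar>freq_response K H f g x\<bar>)"
proof (rule cSUP_upper[OF x], rule bdd_aboveI2)
  fix y assume y: "y \<in> {lo..hi}"
  have "\<bar>freq_response K H f g y\<bar> \<le> (\<Sum>k\<le>K. \<bar>H k $$ (f, g) * y ^ k\<bar>)"
    unfolding freq_response_def by (rule sum_abs)
  also have "\<dots> \<le> (\<Sum>k\<le>K. \<bar>H k $$ (f, g)\<bar> * (\<bar>lo\<bar> + \<bar>hi\<bar>) ^ k)"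
    using y by (intro sum_mono) (auto simp: abs_mult power_abs intro!: mult_left_mono power_mono)
  finally show "\<bar>freq_response K H f g y\<bar> \<le> (\<Sum>k\<le>K. \<bar>H k $$ (f, g)\<bar> * (\<bar>lo\<bar> + \<bar>hi\<bar>) ^ k)" .
qed

text \<open>The mixing bound with the matrix of suprema as weights; each polynomial of
  \<open>S\<close> in the bank stretches vectors by at most the corresponding entry.\<close>

lemma graph_filter_norm_le:
  assumes X: "X \<in> carrier_mat n F" and H: "\<And>k. k \<le> K \<Longrightarrow> H k \<in> carrier_mat F G"
    and S: "admissible_support n lo hi S"
  shows "signal_norm (graph_filter K H S X) \<le> filter_size lo hi K H * signal_norm X"
proof -
  define c where "c = mat F G (\<lambda>(f, g). SUP x\<in>{lo..hi}. \<bar>freq_response K H f g x\<bar>)"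
  have S': "S \<in> carrier_mat n n" using S by (simp add: admissible_support_def)
  have "signal_norm (graph_filter K H S X) \<le> row_sum_norm c * (\<Sum>f<F. vec_l2 (col X f))"
  proof (rule signal_norm_mix_le)
    fix f g assume fg: "f < F" "g < G"
    let ?p = "mat_poly K (\<lambda>k. H k $$ (f, g)) S"
    show "?p *\<^sub>v col X f \<in> carrier_vec n"
      using S' by (auto simp: mat_poly_def intro!: carrier_vecI)
    show "vec_l2 (?p *\<^sub>v col X f) \<le> \<bar>c $$ (f, g)\<bar> * vec_l2 (col X f)"
      using S X fg abs_freq_response_le[of _ lo hi K H f g]
      by (intro mat_poly_norm_le[where n = n and lo = lo and hi = hi])
        (auto simp: c_def freq_response_def admissible_support_def intro: order_trans[OF _ abs_ge_self])
  next
    fix i g assume "i < n" "g < G"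
    then show "graph_filter K H S X $$ (i, g)
      = (\<Sum>f<F. (mat_poly K (\<lambda>k. H k $$ (f, g)) S *\<^sub>v col X f) $ i)"
      using X H S' by (intro graph_filter_index)
  qed (use X H[of 0] in \<open>auto simp: c_def\<close>)
  moreover have "filter_size lo hi K H = row_sum_norm c"
    using H[of 0] by (simp add: filter_size_def c_def)
  ultimately show ?thesis using X by (simp add: signal_norm_def)
qed

text \<open>The mixing bound with the Lipschitz constants as weights; the common factor
  \<open>s\<close> from the change of support goes into the column weights.\<close>

lemma graph_filter_support_diff_le:
  assumes X: "X \<in> carrier_mat n F" and H: "\<And>k. k \<le> K \<Longrightarrow> H k \<in> carrier_mat F G"
    and S: "admissible_support n lo hi S" and T: "admissible_support n lo hi T"
    and lip: "filter_lipschitz lo hi K H \<gamma>"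
  shows "signal_norm (graph_filter K H S X - graph_filter K H T X)
    \<le> row_sum_norm \<gamma> * (sqrt n * spectral_norm (S - T)) * signal_norm X"
proof -
  define s where "s = sqrt n * spectral_norm (S - T)"
  have S': "S \<in> carrier_mat n n" and T': "T \<in> carrier_mat n n"
    using S T by (auto simp: admissible_support_def)
  have FG: "dim_row (H 0) = F" "dim_col (H 0) = G" using H[of 0] by auto
  note gf = graph_filter_carrier[where H = H, OF X H[OF le0]]
  have "signal_norm (graph_filter K H S X - graph_filter K H T X)
      \<le> row_sum_norm \<gamma> * (\<Sum>f<F. s * vec_l2 (col X f))"
  proof (rule signal_norm_mix_le)
    fix f g assume fg: "f < F" "g < G"
    let ?p = "mat_poly K (\<lambda>k. H k $$ (f, g))"
    show "(?p S - ?p T) *\<^sub>v col X f \<in> carrier_vec n"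
      using T' by (auto simp: mat_poly_def intro!: carrier_vecI)
    have "vec_l2 ((?p S - ?p T) *\<^sub>v col X f) \<le> \<gamma> $$ (f, g) * s * vec_l2 (col X f)"
      unfolding s_def using S T X fg lip FG
      by (intro mat_poly_diff_le[where n = n and lo = lo and hi = hi])
        (auto simp: admissible_support_def filter_lipschitz_def freq_response_def less_imp_le)
    also have "\<gamma> $$ (f, g) = \<bar>\<gamma> $$ (f, g)\<bar>"
      using lip fg FG by (simp add: filter_lipschitz_def less_imp_le)
    finally show "vec_l2 ((?p S - ?p T) *\<^sub>v col X f) \<le> \<bar>\<gamma> $$ (f, g)\<bar> * (s * vec_l2 (col X f))"
      by (simp add: mult.assoc)
  next
    fix i g assume ig: "i < n" "g < G"
    let ?p = "\<lambda>f. mat_poly K (\<lambda>k. H k $$ (f, g))"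
    have c: "?p f S \<in> carrier_mat n n" "?p f T \<in> carrier_mat n n" for f
      using S' T' by (auto simp: mat_poly_def)
    have "(?p f S *\<^sub>v col X f) $ i - (?p f T *\<^sub>v col X f) $ i = ((?p f S - ?p f T) *\<^sub>v col X f) $ i"
      if "f < F" for f
    proof -
      have "col X f \<in> carrier_vec n" using X that by auto
      then show ?thesis using c[of f] ig by (simp add: minus_mult_distrib_mat_vec[of _ n n] del: index_mult_mat_vec)
    qed
    then show "(graph_filter K H S X - graph_filter K H T X) $$ (i, g)
      = (\<Sum>f<F. ((?p f S - ?p f T) *\<^sub>v col X f) $ i)"
      using gf[of K S] gf[of K T] ig
      by (simp add: graph_filter_index[OF X H S' ig] graph_filter_index[OF X H T' ig]
          sum_subtractf[symmetric] del: index_mult_mat_vec)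
  qed (use gf lip FG in \<open>auto simp: s_def filter_lipschitz_def intro!: minus_carrier_mat\<close>)
  then show ?thesis
    using X by (simp add: signal_norm_def s_def mult.assoc flip: sum_distrib_left)
qed

lemma graph_filter_minus:
  assumes X: "X \<in> carrier_mat n F" and Y: "Y \<in> carrier_mat n F"
    and H: "\<And>k. k \<le> K \<Longrightarrow> H k \<in> carrier_mat F G" and S: "S \<in> carrier_mat n n"
  shows "graph_filter K H S X - graph_filter K H S Y = graph_filter K H S (X - Y)"
proof (rule eq_matI)
  fix i g
  assume "i < dim_row (graph_filter K H S (X - Y))" "g < dim_col (graph_filter K H S (X - Y))"
  then have ig: "i < n" "g < G" using X Y H[of 0] by (auto simp: graph_filter_def)
  have "S ^\<^sub>m k * X * H k - S ^\<^sub>m k * Y * H k = S ^\<^sub>m k * (X - Y) * H k" if "k \<le> K" for k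
  proof -
    have Sk: "S ^\<^sub>m k \<in> carrier_mat n n" using S by simp
    show ?thesis
      unfolding mult_minus_distrib_mat[OF Sk X Y]
      by (rule minus_mult_distrib_mat[OF mult_carrier_mat[OF Sk X] mult_carrier_mat[OF Sk Y] H[OF that], symmetric])
  qed
  then have "(S ^\<^sub>m k * X * H k) $$ (i, g) - (S ^\<^sub>m k * Y * H k) $$ (i, g) = (S ^\<^sub>m k * (X - Y) * H k) $$ (i, g)"
    if "k \<le> K" for k
    using that ig S Y H[OF that]
    by (metis carrier_matD index_minus_mat(1) index_mult_mat(2,3) pow_mat_dim_square(1))
  then show "(graph_filter K H S X - graph_filter K H S Y) $$ (i, g) = graph_filter K H S (X - Y) $$ (i, g)"
    using ig X Y H[of 0] by (simp add: graph_filter_def sum_subtractf[symmetric] del: index_mult_mat)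
qed (use X Y in \<open>auto simp: graph_filter_def\<close>)

section \<open>Graph neural networks\<close>

text \<open>\<open>Ft_pos\<close> gives every tap matrix at least one row, so that layer sizes and
  Lipschitz constants are genuine maxima and nonnegative.\<close>

locale lipschitz_gnn =
  fixes L :: nat and Ft K :: "nat \<Rightarrow> nat" and H :: "nat \<Rightarrow> nat \<Rightarrow> real mat"
    and \<gamma> :: "nat \<Rightarrow> real mat" and lo hi :: real and \<sigma> :: "real \<Rightarrow> real"
  assumes Ft_pos: "l \<le> L \<Longrightarrow> Ft l > 0"
    and taps: "gnn_taps L Ft K H"
    and lip: "l \<in> {1..L} \<Longrightarrow> filter_lipschitz lo hi (K l) (H l) (\<gamma> l)"
    and \<sigma>_lip: "\<bar>\<sigma> a - \<sigma> b\<bar> \<le> \<bar>a - b\<bar>" and \<sigma>_0: "\<sigma> 0 = 0"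
begin

abbreviation "C \<equiv> gnn_size lo hi K H"
abbreviation "\<Gamma> \<equiv> gnn_lip lo hi K H \<gamma>"
abbreviation "\<Phi> \<equiv> gnn \<sigma> K H"
abbreviation "layer_size l \<equiv> filter_size lo hi (K l) (H l)"

section \<open>Dimensions and signs of the constants\<close>

lemma tap_carrier:
  assumes "Suc l \<le> L" and "k \<le> K (Suc l)"
  shows "H (Suc l) k \<in> carrier_mat (Ft l) (Ft (Suc l))"
  using taps assms unfolding gnn_taps_def by fastforce

lemma gnn_carrier:
  assumes "X \<in> carrier_mat n (Ft 0)" and "l \<le> L"
  shows "\<Phi> l X S \<in> carrier_mat n (Ft l)"
  using assms
proof (induction l)
  case (Suc l)
  then show ?case
    using graph_filter_carrier[where H = "H (Suc l)", OF _ tap_carrier[of l 0]] by simp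
qed simp

lemma layer_size_nonneg:
  assumes "l \<in> {1..L}"
  shows "layer_size l \<ge> 0"
proof -
  obtain m where m: "l = Suc m" using assms by (cases l) auto
  then show ?thesis
    using tap_carrier[of m 0] Ft_pos[of m] assms
    unfolding filter_size_def by (intro row_sum_norm_nonneg) auto
qed

lemma row_sum_norm_\<gamma>_nonneg:
  assumes "l \<in> {1..L}"
  shows "row_sum_norm (\<gamma> l) \<ge> 0"
proof -
  obtain m where m: "l = Suc m" using assms by (cases l) auto
  then show ?thesis
    using tap_carrier[of m 0] Ft_pos[of m] assms lip[OF assms]
    unfolding filter_lipschitz_def by (intro row_sum_norm_nonneg) auto
qed

lemma gnn_size_Suc: "C (Suc l) = C l * layer_size (Suc l)"
  by (simp add: gnn_size_def)

lemma gnn_size_nonneg: "l \<le> L \<Longrightarrow> C l \<ge> 0"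
  unfolding gnn_size_def by (intro prod_nonneg) (auto intro: layer_size_nonneg)

lemma gnn_lip_nonneg: "l \<le> L \<Longrightarrow> \<Gamma> l \<ge> 0"
  unfolding gnn_lip_def
  by (intro sum_nonneg divide_nonneg_nonneg) (auto intro: layer_size_nonneg row_sum_norm_\<gamma>_nonneg)

section \<open>Bounds propagated through the layers\<close>

lemma activation_norm_le: "signal_norm (map_mat \<sigma> X) \<le> signal_norm X"
  using \<sigma>_lip[of _ 0] \<sigma>_0
  by (intro signal_norm_mono[of _ "dim_row X" "dim_col X"]) auto

lemma activation_diff_le:
  assumes "X \<in> carrier_mat n m" and "Y \<in> carrier_mat n m"
  shows "signal_norm (map_mat \<sigma> X - map_mat \<sigma> Y) \<le> signal_norm (X - Y)"
  using assms \<sigma>_lip by (intro signal_norm_mono[of _ n m]) (auto intro!: minus_carrier_mat)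

lemma gnn_norm_le:
  assumes X: "X \<in> carrier_mat n (Ft 0)" and S: "admissible_support n lo hi S" and "l \<le> L"
  shows "signal_norm (\<Phi> l X S) \<le> C l * signal_norm X"
  using \<open>l \<le> L\<close>
proof (induction l)
  case 0
  show ?case by (simp add: gnn_size_def)
next
  case (Suc l)
  have "signal_norm (\<Phi> (Suc l) X S) \<le> signal_norm (graph_filter (K (Suc l)) (H (Suc l)) S (\<Phi> l X S))"
    using activation_norm_le by simp
  also have "\<dots> \<le> layer_size (Suc l) * signal_norm (\<Phi> l X S)"
    using Suc.prems
    by (intro graph_filter_norm_le[where n = n and F = "Ft l" and G = "Ft (Suc l)"] gnn_carrier X tap_carrier S) auto
  also have "\<dots> \<le> layer_size (Suc l) * (C l * signal_norm X)"
    using Suc layer_size_nonneg[of "Suc l"] by (intro mult_left_mono) auto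
  finally show ?case by (simp add: gnn_size_Suc mult_ac)
qed

text \<open>For a fixed support a filter is linear in its input, so the size that bounds outputs
  also bounds differences, layer by layer.\<close>

lemma gnn_diff_le:
  assumes X: "X \<in> carrier_mat n (Ft 0)" and Y: "Y \<in> carrier_mat n (Ft 0)"
    and S: "admissible_support n lo hi S" and "l \<le> L"
  shows "signal_norm (\<Phi> l X S - \<Phi> l Y S) \<le> C l * signal_norm (X - Y)"
  using \<open>l \<le> L\<close>
proof (induction l)
  case 0
  show ?case by (simp add: gnn_size_def)
next
  case (Suc l)
  let ?gf = "graph_filter (K (Suc l)) (H (Suc l)) S"
  have c: "\<Phi> l X S \<in> carrier_mat n (Ft l)" "\<Phi> l Y S \<in> carrier_mat n (Ft l)"
    using Suc.prems by (auto intro!: gnn_carrier X Y)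
  note H = tap_carrier[OF Suc.prems]
  have S': "S \<in> carrier_mat n n" using S by (simp add: admissible_support_def)
  have "signal_norm (\<Phi> (Suc l) X S - \<Phi> (Suc l) Y S) \<le> signal_norm (?gf (\<Phi> l X S) - ?gf (\<Phi> l Y S))"
    using c H[of 0] by (auto intro!: activation_diff_le[of _ n "Ft (Suc l)"] graph_filter_carrier)
  also have "\<dots> = signal_norm (?gf (\<Phi> l X S - \<Phi> l Y S))"
    by (simp only: graph_filter_minus[where H = "H (Suc l)", OF c H S'])
  also have "\<dots> \<le> layer_size (Suc l) * signal_norm (\<Phi> l X S - \<Phi> l Y S)"
    by (intro graph_filter_norm_le[where n = n and F = "Ft l" and G = "Ft (Suc l)"] minus_carrier_mat c H S)
  also have "\<dots> \<le> layer_size (Suc l) * (C l * signal_norm (X - Y))"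
    using Suc layer_size_nonneg[of "Suc l"] by (intro mult_left_mono) auto
  finally show ?case by (simp add: gnn_size_Suc mult_ac)
qed

text \<open>Each layer adds a fresh error, its Lipschitz constant times the size of the layers
  before it, and amplifies the old error by its own size. Relative to the total size the fresh
  errors are the quotients summed in \<open>\<Gamma>\<close>.\<close>

lemma gnn_support_diff_le:
  assumes X: "X \<in> carrier_mat n (Ft 0)" and S: "admissible_support n lo hi S"
    and T: "admissible_support n lo hi T" and "l \<le> L"
  shows "signal_norm (\<Phi> l X S - \<Phi> l X T)
    \<le> C l * \<Gamma> l * (sqrt n * spectral_norm (S - T)) * signal_norm X"
  using \<open>l \<le> L\<close>
proof (induction l)
  case 0
  have "X - X = 0\<^sub>m n (Ft 0)" using X by (intro eq_matI) auto
  then have "signal_norm (X - X) \<le> 0"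
    using X by (simp add: signal_norm_def vec_l2_def L2_set_def)
  then show ?case by (simp add: gnn_lip_def)
next
  case (Suc l)
  let ?s = "sqrt n * spectral_norm (S - T)"
  let ?gf = "graph_filter (K (Suc l)) (H (Suc l))"
  have c: "\<Phi> l X S \<in> carrier_mat n (Ft l)" "\<Phi> l X T \<in> carrier_mat n (Ft l)"
    using Suc.prems by (auto intro!: gnn_carrier X)
  note H = tap_carrier[OF Suc.prems]
  have l: "Suc l \<in> {1..L}" using Suc.prems by simp
  have T': "T \<in> carrier_mat n n" using T by (simp add: admissible_support_def)
  have gf: "?gf R Y \<in> carrier_mat n (Ft (Suc l))" if "Y \<in> carrier_mat n (Ft l)" for R Y
    using that H[of 0] by (auto intro!: graph_filter_carrier)
  show ?case
  proof (cases "layer_size (Suc l) = 0")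
    case True
    \<comment> \<open>The quotient in \<open>\<Gamma> (Suc l)\<close> has the junk value 0 here, but both outputs vanish.\<close>
    then have "C (Suc l) = 0" by (simp add: gnn_size_Suc)
    moreover have "signal_norm (\<Phi> (Suc l) X S - \<Phi> (Suc l) X T)
        \<le> signal_norm (\<Phi> (Suc l) X S) + signal_norm (\<Phi> (Suc l) X T)"
      by (rule signal_norm_diff_le[OF gnn_carrier[OF X Suc.prems] gnn_carrier[OF X Suc.prems]])
    ultimately show ?thesis
      using gnn_norm_le[OF X S Suc.prems] gnn_norm_le[OF X T Suc.prems] by (simp del: gnn.simps)
  next
    case False
    have "signal_norm (\<Phi> (Suc l) X S - \<Phi> (Suc l) X T)
        \<le> signal_norm (?gf S (\<Phi> l X S) - ?gf T (\<Phi> l X T))"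
      using c gf by (auto intro!: activation_diff_le[of _ n "Ft (Suc l)"])
    \<comment> \<open>The support of this layer is changed first, on the unchanged input; then the
      input is changed under the new support \<open>T\<close>.\<close>
    also have "\<dots> \<le> signal_norm (?gf S (\<Phi> l X S) - ?gf T (\<Phi> l X S))
        + signal_norm (?gf T (\<Phi> l X S) - ?gf T (\<Phi> l X T))"
      by (rule signal_norm_triangle[OF gf[OF c(1)] gf[OF c(1)] gf[OF c(2)]])
    also have "signal_norm (?gf S (\<Phi> l X S) - ?gf T (\<Phi> l X S))
        \<le> row_sum_norm (\<gamma> (Suc l)) * ?s * signal_norm (\<Phi> l X S)"
      by (rule graph_filter_support_diff_le[where H = "H (Suc l)", OF c(1) H S T lip[OF l]])
    also have "\<dots> \<le> row_sum_norm (\<gamma> (Suc l)) * ?s * (C l * signal_norm X)"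
      using gnn_norm_le[OF X S, of l] Suc.prems row_sum_norm_\<gamma>_nonneg[OF l]
      by (intro mult_left_mono) auto
    also have "signal_norm (?gf T (\<Phi> l X S) - ?gf T (\<Phi> l X T))
        = signal_norm (?gf T (\<Phi> l X S - \<Phi> l X T))"
      by (simp only: graph_filter_minus[where H = "H (Suc l)", OF c H T'])
    also have "\<dots> \<le> layer_size (Suc l) * signal_norm (\<Phi> l X S - \<Phi> l X T)"
      by (intro graph_filter_norm_le[where n = n and F = "Ft l" and G = "Ft (Suc l)"] minus_carrier_mat c H T)
    also have "\<dots> \<le> layer_size (Suc l) * (C l * \<Gamma> l * ?s * signal_norm X)"
      using Suc layer_size_nonneg[OF l] by (intro mult_left_mono) auto
    \<comment> \<open>As the layer size is nonzero, it can be cancelled against the denominator of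
      the new quotient in \<open>\<Gamma> (Suc l)\<close>.\<close>
    also have "row_sum_norm (\<gamma> (Suc l)) * ?s * (C l * signal_norm X)
        + layer_size (Suc l) * (C l * \<Gamma> l * ?s * signal_norm X)
        = C (Suc l) * \<Gamma> (Suc l) * ?s * signal_norm X"
      using False by (simp add: gnn_size_Suc gnn_lip_def field_simps)
    finally show ?thesis by simp
  qed
qed

end

section \<open>Closed-loop trajectories\<close>

text \<open>Each norm is a lower bound of the set of admissible numbers, hence at most its infimum,
  whether or not the infimum is attained. Equal systems are thereby covered.\<close>

lemma system_dist_bounds:
  fixes S A Ab B Bb S' A' Ab' B' Bb' :: "real mat"
  defines "\<epsilon> \<equiv> system_dist (S, A, Ab, B, Bb) (S', A', Ab', B', Bb')"
  shows "spectral_norm (S - S') \<le> \<epsilon>" "spectral_norm (A - A') \<le> \<epsilon>" "row_sum_norm (Ab - Ab') \<le> \<epsilon>"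
    "spectral_norm (B - B') \<le> \<epsilon>" "row_sum_norm (Bb - Bb') \<le> \<epsilon>"
proof -
  let ?E = "{\<epsilon>. \<epsilon> > 0 \<and> spectral_norm (S - S') \<le> \<epsilon> \<and>
       spectral_norm (A - A') \<le> \<epsilon> \<and> row_sum_norm (Ab - Ab') \<le> \<epsilon> \<and>
       spectral_norm (B - B') \<le> \<epsilon> \<and> row_sum_norm (Bb - Bb') \<le> \<epsilon>}"
  \<comment> \<open>The entry 1 ensures that the witness is positive even if all differences
    vanish.\<close>
  have "Max {1, spectral_norm (S - S'), spectral_norm (A - A'), row_sum_norm (Ab - Ab'),
      spectral_norm (B - B'), row_sum_norm (Bb - Bb')} \<in> ?E"
    by (auto simp: less_max_iff_disj)
  then have "?E \<noteq> {}" by blast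
  then show "spectral_norm (S - S') \<le> \<epsilon>" "spectral_norm (A - A') \<le> \<epsilon>" "row_sum_norm (Ab - Ab') \<le> \<epsilon>"
    "spectral_norm (B - B') \<le> \<epsilon>" "row_sum_norm (Bb - Bb') \<le> \<epsilon>"
    unfolding \<epsilon>_def system_dist.simps by (auto intro: cInf_greatest)
qed

text \<open>The source decays or grows with rate \<open>a\<close>, the error with rate
  \<open>b\<close>. Bounding both by the maximum makes each of the \<open>t\<close> source terms
  contribute the same power \<open>t - 1\<close>.\<close>

lemma perturbed_linear_recursion:
  fixes e x :: "nat \<Rightarrow> real"
  assumes e0: "e 0 \<le> 0" and e: "\<And>t. e (Suc t) \<le> b * e t + c * x t"
    and x: "\<And>t. x (Suc t) \<le> a * x t" and x0: "x 0 \<ge> 0"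
    and nonneg: "a \<ge> 0" "b \<ge> 0" "c \<ge> 0"
  shows "e t \<le> c * (if t = 0 then 0 else real t * max a b ^ (t - 1)) * x 0"
proof -
  let ?m = "max a b"
  have m: "?m \<ge> 0" using nonneg by simp
  have xt: "x t \<le> ?m ^ t * x 0" for t
  proof (induction t)
    case (Suc t)
    have "x (Suc t) \<le> a * (?m ^ t * x 0)"
      using x[of t] Suc nonneg by (meson mult_left_mono order_trans)
    also have "\<dots> \<le> ?m * (?m ^ t * x 0)"
      using m x0 by (intro mult_right_mono) auto
    finally show ?case by (simp add: mult_ac)
  qed simp
  show ?thesis
  proof (induction t)
    case 0
    then show ?case using e0 by simp
  next
    case (Suc t)
    have "e (Suc t) \<le> b * e t + c * x t" by (rule e)
    also have "b * e t \<le> b * (c * (if t = 0 then 0 else real t * ?m ^ (t - 1)) * x 0)"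
      using Suc nonneg by (intro mult_left_mono)
    also have "\<dots> \<le> ?m * (c * (if t = 0 then 0 else real t * ?m ^ (t - 1)) * x 0)"
      using nonneg x0 m by (intro mult_right_mono) auto
    \<comment> \<open>Subtraction is truncated at 0, so \<open>t = 0\<close> is a separate case, in
      which both sides vanish.\<close>
    also have "\<dots> = c * (real t * ?m ^ t) * x 0"
      by (cases t) auto
    also have "c * x t \<le> c * (?m ^ t * x 0)"
      using xt nonneg by (intro mult_left_mono)
    finally show ?case by (simp add: algebra_simps)
  qed
qed

lemma add_diff_add_mat:
  fixes P Q R T :: "real mat"
  assumes "P \<in> carrier_mat n m" "Q \<in> carrier_mat n m" "R \<in> carrier_mat n m" "T \<in> carrier_mat n m"
  shows "(P + Q) - (R + T) = (P - R) + (Q - T)"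
  using assms by (intro eq_matI) auto

section \<open>Stability of the closed loop\<close>

theorem theorem3:
  fixes S A Ab B Bb Sh Ah Abh Bh Bbh :: "real mat"
    and N F G L :: nat and E :: "(nat \<times> nat) set"
    and Ft K :: "nat \<Rightarrow> nat" and H :: "nat \<Rightarrow> nat \<Rightarrow> real mat" and \<gamma> :: "nat \<Rightarrow> real mat"
    and lo hi :: real and \<sigma> :: "real \<Rightarrow> real"
    and X Xh :: "nat \<Rightarrow> real mat" and t :: nat
  defines "D \<equiv> (S, A, Ab, B, Bb)"
    and "Dh \<equiv> (Sh, Ah, Abh, Bh, Bbh)"
    and "C\<Phi> \<equiv> gnn_size lo hi K H L"
    and "\<Gamma>\<Phi> \<equiv> gnn_lip lo hi K H \<gamma> L"
  assumes "N > 0" and "\<forall>l\<le>L. Ft l > 0" and "Ft 0 = F" and "Ft L = G"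
    and "system_dims N F G D" and "system_dims N F G Dh"
    and "E \<subseteq> {..<N} \<times> {..<N}" and "support_matrix N E S"
    and "transpose_mat S = S" and "transpose_mat Sh = Sh"
    and "spectrum_in S lo hi" and "spectrum_in Sh lo hi"
    and "gnn_taps L Ft K H"
    and "\<forall>l\<in>{1..L}. filter_lipschitz lo hi (K l) (H l) (\<gamma> l)"
    and "\<forall>a b. \<bar>\<sigma> a - \<sigma> b\<bar> \<le> \<bar>a - b\<bar>" and "\<sigma> 0 = 0"
    and "X 0 \<in> carrier_mat N F" and "Xh 0 = X 0"
    and "closed_loop (gnn \<sigma> K H L) D X"
    and "closed_loop (gnn \<sigma> K H L) Dh Xh"
  shows "signal_norm (X t - Xh t)
    \<le> C_Phi_hat C\<Phi> \<Gamma>\<Phi> N D Dh * C_t_hat C\<Phi> D Dh t * signal_norm (X 0) * system_dist D Dh"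
proof -
  interpret lipschitz_gnn L Ft K H \<gamma> lo hi \<sigma>
    using assms(6,17-20) by unfold_locales auto
  note dims = assms(9,10)[unfolded D_def Dh_def system_dims.simps]
  have S: "admissible_support N lo hi S" and Sh: "admissible_support N lo hi Sh"
    using assms(13-16) dims by (auto simp: admissible_support_def)
  have F: "F > 0" and G: "G > 0" using Ft_pos assms(7,8) by auto
  have C_nonneg: "C\<Phi> \<ge> 0" and \<Gamma>_nonneg: "\<Gamma>\<Phi> \<ge> 0"
    by (simp_all add: C\<Phi>_def \<Gamma>\<Phi>_def gnn_size_nonneg gnn_lip_nonneg)
  have rows: "row_sum_norm Ab \<ge> 0" "row_sum_norm Bb \<ge> 0" "row_sum_norm Abh \<ge> 0" "row_sum_norm Bbh \<ge> 0"
    using dims F G by (auto intro!: row_sum_norm_nonneg)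
  define \<epsilon> where "\<epsilon> = system_dist D Dh"
  note \<epsilon> = system_dist_bounds[where S = S and A = A and Ab = Ab and B = B and Bb = Bb
      and S' = Sh and A' = Ah and Ab' = Abh and B' = Bh and Bb' = Bbh, folded D_def Dh_def \<epsilon>_def]
  have \<epsilon>0: "\<epsilon> \<ge> 0" using \<epsilon>(1) spectral_norm_nonneg[of "S - Sh"] by linarith

  have step: "X (Suc t) = A * X t * Ab + B * \<Phi> L (X t) S * Bb"
      "Xh (Suc t) = Ah * Xh t * Abh + Bh * \<Phi> L (Xh t) Sh * Bbh" for t
    using assms(23,24) by (simp_all add: D_def Dh_def)
  have \<Phi>_carrier: "\<Phi> L Y R \<in> carrier_mat N G" if "Y \<in> carrier_mat N F" for Y R
    using gnn_carrier[of Y N L R] that assms(7,8) by simp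
  have sandwich_carrier: "P * Y * Q \<in> carrier_mat N F"
    if "P \<in> carrier_mat N N" "Y \<in> carrier_mat N m" "Q \<in> carrier_mat m F" for P Y Q :: "real mat" and m
    using that by simp
  have X: "X t \<in> carrier_mat N F" for t
  proof (induction t)
    case (Suc t)
    then show ?case
      unfolding step using dims \<Phi>_carrier[OF Suc] by (intro add_carrier_mat mult_carrier_mat) auto
  qed (use assms(21) in simp)
  have Xh: "Xh t \<in> carrier_mat N F" for t
  proof (induction t)
    case (Suc t)
    then show ?case
      unfolding step using dims \<Phi>_carrier[OF Suc] by (intro add_carrier_mat mult_carrier_mat) auto
  qed (use assms(21,22) in simp)

  have \<Phi>_norm: "signal_norm (\<Phi> L (X t) S) \<le> C\<Phi> * signal_norm (X t)" for t
    using gnn_norm_le[OF _ S, of "X t" L] X[of t] assms(7) by (simp add: C\<Phi>_def)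
  have \<Phi>_diff: "signal_norm (\<Phi> L (X t) S - \<Phi> L (Xh t) Sh)
      \<le> C\<Phi> * \<Gamma>\<Phi> * ((1 + 8 * sqrt N) * \<epsilon>) * signal_norm (X t) + C\<Phi> * signal_norm (X t - Xh t)" for t
  proof -
    \<comment> \<open>Passing through the perturbed support with the unperturbed state leaves the
      norm of \<open>X t\<close>, not of \<open>Xh t\<close>, in the source term.\<close>
    have "signal_norm (\<Phi> L (X t) S - \<Phi> L (Xh t) Sh)
        \<le> signal_norm (\<Phi> L (X t) S - \<Phi> L (X t) Sh) + signal_norm (\<Phi> L (X t) Sh - \<Phi> L (Xh t) Sh)"
      by (rule signal_norm_triangle[OF \<Phi>_carrier[OF X] \<Phi>_carrier[OF X] \<Phi>_carrier[OF Xh]])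
    also have "signal_norm (\<Phi> L (X t) S - \<Phi> L (X t) Sh)
        \<le> C\<Phi> * \<Gamma>\<Phi> * (sqrt N * spectral_norm (S - Sh)) * signal_norm (X t)"
      using gnn_support_diff_le[OF _ S Sh, of "X t" L] X[of t] assms(7) by (simp add: C\<Phi>_def \<Gamma>\<Phi>_def)
    \<comment> \<open>Here the factor \<open>sqrt N\<close> is weakened to the stated
      \<open>1 + 8 * sqrt N\<close>.\<close>
    also have "\<dots> \<le> C\<Phi> * \<Gamma>\<Phi> * ((1 + 8 * sqrt N) * \<epsilon>) * signal_norm (X t)"
      using C_nonneg \<Gamma>_nonneg \<epsilon>(1) by (intro mult_right_mono mult_left_mono mult_mono) auto
    also have "signal_norm (\<Phi> L (X t) Sh - \<Phi> L (Xh t) Sh) \<le> C\<Phi> * signal_norm (X t - Xh t)"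
      using gnn_diff_le[OF _ _ Sh, of "X t" "Xh t" L] X[of t] Xh[of t] assms(7) by (simp add: C\<Phi>_def)
    finally show ?thesis by simp
  qed

  \<comment> \<open>The bound is regrouped to match the recursion lemma: \<open>C_Phi_hat\<close>
    times \<open>\<epsilon>\<close> is the source coefficient, and the two stability constants are
    the rates of state and error.\<close>
  have "signal_norm (X t - Xh t) \<le> (C_Phi_hat C\<Phi> \<Gamma>\<Phi> N D Dh * \<epsilon>)
      * (if t = 0 then 0 else real t * max (stability_const C\<Phi> D) (stability_const C\<Phi> Dh) ^ (t - 1))
      * signal_norm (X 0)"
  proof (rule perturbed_linear_recursion[where x = "\<lambda>t. signal_norm (X t)" and e = "\<lambda>t. signal_norm (X t - Xh t)"])
    have "X 0 - X 0 = 0\<^sub>m N F" using X[of 0] by (intro eq_matI) auto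
    then show "signal_norm (X 0 - Xh 0) \<le> 0"
      using assms(22) by (simp add: signal_norm_def vec_l2_def L2_set_def)
  next
    fix t
    note cX = dims X[of t] \<Phi>_carrier[OF X[of t]]
    have "signal_norm (X (Suc t)) \<le> signal_norm (A * X t * Ab) + signal_norm (B * \<Phi> L (X t) S * Bb)"
      unfolding step using cX by (intro signal_norm_add_le[of _ N F] mult_carrier_mat) auto
    also have "signal_norm (A * X t * Ab) \<le> spectral_norm A * row_sum_norm Ab * signal_norm (X t)"
      using cX F by (intro signal_norm_sandwich_le) auto
    also have "signal_norm (B * \<Phi> L (X t) S * Bb)
        \<le> spectral_norm B * row_sum_norm Bb * signal_norm (\<Phi> L (X t) S)"
      using cX G by (intro signal_norm_sandwich_le) auto
    also have "\<dots> \<le> spectral_norm B * row_sum_norm Bb * (C\<Phi> * signal_norm (X t))"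
      using \<Phi>_norm rows by (intro mult_left_mono) auto
    finally show "signal_norm (X (Suc t)) \<le> stability_const C\<Phi> D * signal_norm (X t)"
      by (simp add: D_def algebra_simps)
  next
    fix t
    let ?x = "signal_norm (X t)" and ?e = "signal_norm (X t - Xh t)"
    let ?Y = "\<Phi> L (X t) S" and ?Yh = "\<Phi> L (Xh t) Sh"
    note cX = dims X[of t] Xh[of t] \<Phi>_carrier[OF X[of t]] \<Phi>_carrier[OF Xh[of t]]
    have c: "A * X t * Ab \<in> carrier_mat N F" "Ah * Xh t * Abh \<in> carrier_mat N F"
      using cX by (auto intro!: sandwich_carrier[where m = F])
    have c': "B * ?Y * Bb \<in> carrier_mat N F" "Bh * ?Yh * Bbh \<in> carrier_mat N F"
      using cX by (auto intro!: sandwich_carrier[where m = G])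
    have "X (Suc t) - Xh (Suc t)
        = (A * X t * Ab - Ah * Xh t * Abh) + (B * ?Y * Bb - Bh * ?Yh * Bbh)"
      unfolding step by (rule add_diff_add_mat[OF c(1) c'(1) c(2) c'(2)])
    then have "signal_norm (X (Suc t) - Xh (Suc t))
        \<le> signal_norm (A * X t * Ab - Ah * Xh t * Abh) + signal_norm (B * ?Y * Bb - Bh * ?Yh * Bbh)"
      using signal_norm_add_le[OF minus_carrier_mat[OF c(2)] minus_carrier_mat[OF c'(2)]] by simp
    also have "signal_norm (A * X t * Ab - Ah * Xh t * Abh)
        \<le> (spectral_norm A + row_sum_norm Abh) * \<epsilon> * ?x + spectral_norm Ah * row_sum_norm Abh * ?e"
      using cX F \<epsilon> by (intro signal_norm_sandwich_diff_le[of _ N _ _ F]) auto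
    also have "signal_norm (B * ?Y * Bb - Bh * ?Yh * Bbh)
        \<le> (spectral_norm B + row_sum_norm Bbh) * \<epsilon> * signal_norm ?Y
          + spectral_norm Bh * row_sum_norm Bbh * signal_norm (?Y - ?Yh)"
      using cX G \<epsilon> by (intro signal_norm_sandwich_diff_le[of _ N _ _ G]) auto
    also have "\<dots> \<le> (spectral_norm B + row_sum_norm Bbh) * \<epsilon> * (C\<Phi> * ?x)
          + spectral_norm Bh * row_sum_norm Bbh
            * (C\<Phi> * \<Gamma>\<Phi> * ((1 + 8 * sqrt N) * \<epsilon>) * ?x + C\<Phi> * ?e)"
      using \<Phi>_norm \<Phi>_diff rows \<epsilon>0 by (intro add_mono mult_left_mono) auto
    \<comment> \<open>Collecting terms: those with the error form the stability constant of
      \<open>Dh\<close>. Those with the state form \<open>C_Phi_hat\<close>, whose second summand is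
      the support error passed through \<open>Bh\<close> and \<open>Bbh\<close>.\<close>
    finally show "signal_norm (X (Suc t) - Xh (Suc t))
        \<le> stability_const C\<Phi> Dh * ?e + C_Phi_hat C\<Phi> \<Gamma>\<Phi> N D Dh * \<epsilon> * ?x"
      by (simp add: D_def Dh_def algebra_simps)
  qed (use C_nonneg \<Gamma>_nonneg \<epsilon>0 rows in \<open>auto simp: D_def Dh_def\<close>)
  then show ?thesis
    by (simp add: C_t_hat_def \<epsilon>_def mult_ac)
qed

end
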